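(* Let $Q$ be a Lie groupoid on $X$ and let $\mathcal{U}_s=\{(U_i,H_i):i\in I\}$ be a strictly regular atlas for the Lie local subgroupoid $s$ of $Q$. Let $G=\mathrm{glob}(s)$ and $W(\mathcal{U}_s)=\bigcup_{i\in I}H_i$. Then $(G,W(\mathcal{U}_s))$ admits the structure of a locally Lie groupoid.
   Context: Fix $r\geq -1$ (also $r=\infty,\omega$ allowed); "manifold" and "smooth" mean $C^r$-manifold and $C^r$-map, where for $r=-1$ a manifold is a topological space and smooth means continuous, and for $r=0$ manifolds are topological manifolds and smooth means continuous. For a groupoid $G$, $\alpha,\beta$ denote source and target, $O_G$ the set of objects (identified with the identities), and the composite $uv$ is defined when $\beta u=\alpha v$. The difference map is $\delta:G\times_\alpha G\to G$, $(g,h)\mapsto g^{-1}h$, where $G\times_\alpha G=\{(g,h):\alpha g=\alpha h\}$. A subgroupoid is wide if it contains all the objects. Lie groupoid: a topological groupoid $G$ such that (i) the space of arrows is a smooth manifold and the space of objects is a smooth submanifold of it; (ii) $\alpha,\beta$ are smooth submersions; (iii) $G\times_\alpha G$ is a smooth submanifold of $G\times G$; (iv) $\delta$ is smooth. Admissible local section of a groupoid $G$ whose object set $X$ is a manifold: a function $\sigma:U\to G$, $U$ open in $X$, with $\alpha\sigma(x)=x$ for $x\in U$, $\beta\sigma(U)$ open in $X$, and $\beta\sigma$ mapping $U$ diffeomorphically onto $\beta\sigma(U)$. If $W\subseteq G$ has a smooth manifold structure with $X$ as a submanifold, $(\alpha,\beta,W)$ is locally sectionable if for each $w\in W$ there is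 an admissible local section $\sigma:U\to G$ with $\sigma\alpha(w)=w$, $\sigma(U)\subseteq W$, and $\sigma:U\to W$ smooth. Locally Lie groupoid: a pair $(G,W)$ of a groupoid $G$ (with no topology assumed) and a smooth manifold $W$ such that G1) $O_G\subseteq W\subseteq G$; G2) $W=W^{-1}$; G3) $W(\delta)=(W\times_\alpha W)\cap\delta^{-1}(W)$ is open in $W\times_\alpha W$ and $\delta|W(\delta)$ is smooth; G4) the restrictions of $\alpha,\beta$ to $W$ are smooth and $(\alpha,\beta,W)$ is locally sectionable; G5) $W$ generates $G$ as a groupoid. Local subgroupoids: let $Q$ be a groupoid on a topological space $X$; for $U$ open in $X$, $Q|U$ is the full subgroupoid on $U$, and $L_Q(U)$ is the set of wide subgroupoids of $Q|U$; with restriction maps $H\mapsto H|V$ this is a presheaf. A local subgroupoid $s$ of $Q$ is a global section of the associated sheaf; so $s(x)$ is a germ $[U,H]_x$ ($x\in U$ open, $H\in L_Q(U)$), where $[U,H]_x=[V,K]_x$ iff $H|W=K|W$ for some open $W$ with $x\in W\subseteq U\cap V$. An atlas $\mathcal{U}_s=\{(U_i,H_i):i\in I\}$ for $s$ is an open cover $\{U_i\}$ of $X$ with wide subgroupoids $H_i$ of $Q|U_i$ such that $s(x)=[U_i,H_i]_x$ whenever $x\in U_i$. Partial order on germs: $[U',H']_x\leq[U,H]_x$ if $H'|W\subseteq H|W$ for some open $W$ with $x\in W\subseteq U\cap U'$; $s\leq t$ iff $s(x)\leq t(x)$ for all $x$. For a wide subgroupoid $H$ of $Q$, $\mathrm{loc}(H)(x)=[X,H]_x$.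 $\mathrm{glob}(s)$ is the intersection of all wide subgroupoids $H$ of $Q$ with $s\leq\mathrm{loc}(H)$. $\mathrm{glob}(\mathcal{U}_s)$ is the subgroupoid of $Q$ generated by all the $H_i$. The atlas is globally adapted if $\mathrm{glob}(s)=\mathrm{glob}(\mathcal{U}_s)$. For $Q$ a Lie groupoid, $s$ is a Lie local subgroupoid if it is given by an atlas $\{(U_i,H_i)\}$ in which each $H_i$ is a Lie subgroupoid of $Q$ (a Lie groupoid on $U_i$ and a submanifold of $Q$). Such an atlas is regular if each $(\alpha_i,\beta_i,H_i)$ is locally sectionable ($\alpha_i,\beta_i$ being source and target of $H_i$). It is strictly regular if (i) it is globally adapted to $s$; (ii) it is regular; (iii) $W(\mathcal{U}_s)=\bigcup_iH_i$ has, with its topology as a subset of $Q$, the structure of a smooth submanifold containing each $H_i$ as an open submanifold, and $W(\mathcal{U}_s)(\delta)=(W(\mathcal{U}_s)\times_\alpha W(\mathcal{U}_s))\cap\delta^{-1}(W(\mathcal{U}_s))$ is open in $W(\mathcal{U}_s)\times_\alpha W(\mathcal{U}_s)$. *)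

theory Defs
  imports "HOL-Analysis.Analysis"
begin

section \<open>Maps of class \<open>C\<^sup>r\<close> between subsets of Euclidean spaces\<close>

text \<open>The parameter \<open>r\<close>: \<open>C_top\<close> is \<open>r = -1\<close>, \<open>C_fin k\<close> is \<open>r = k \<ge> 0\<close>, \<open>C_inf\<close> is \<open>r = \<infinity>\<close> and
  \<open>C_an\<close> is \<open>r = \<omega>\<close>.\<close>

datatype diffclass = C_top | C_fin nat | C_inf | C_an

text \<open>\<open>\<real>\<^sup>n\<close> is \<^const>\<open>Euclidean_space\<close> \<open>n\<close>: sequences vanishing from index \<open>n\<close> on. Hence for \<open>k \<le> n\<close>,
  \<open>\<real>\<^sup>k\<close> is literally the coordinate subspace of \<open>\<real>\<^sup>n\<close> on which the last \<open>n - k\<close> coordinates vanish.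
  The next three definitions are meant for open subsets \<open>S\<close> of \<open>\<real>\<^sup>n\<close>.\<close>

fun Ck_on :: "nat \<Rightarrow> nat \<Rightarrow> (nat \<Rightarrow> real) set \<Rightarrow> ((nat \<Rightarrow> real) \<Rightarrow> real) \<Rightarrow> bool" where
  "Ck_on 0 n S g = continuous_map (subtopology (Euclidean_space n) S) euclideanreal g"
| "Ck_on (Suc k) n S g =
    (continuous_map (subtopology (Euclidean_space n) S) euclideanreal g \<and>
     (\<forall>i<n. \<exists>g'. (\<forall>x\<in>S. ((\<lambda>t. g (x(i := t))) has_real_derivative g' x) (at (x i))) \<and>
        Ck_on k n S g'))"

definition analytic_fun_on :: "nat \<Rightarrow> (nat \<Rightarrow> real) set \<Rightarrow> ((nat \<Rightarrow> real) \<Rightarrow> real) \<Rightarrow> bool" where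
  "analytic_fun_on n S g \<longleftrightarrow>
    (\<forall>x\<in>S. \<exists>e>0. \<exists>a :: (nat \<Rightarrow> nat) \<Rightarrow> real.
       \<forall>y\<in>S. (\<forall>i<n. \<bar>y i - x i\<bar> < e) \<longrightarrow>
         ((\<lambda>m. a m * (\<Prod>i<n. (y i - x i) ^ m i)) has_sum g y) {m. \<forall>i\<ge>n. m i = 0})"

definition Cr_on :: "diffclass \<Rightarrow> nat \<Rightarrow> (nat \<Rightarrow> real) set \<Rightarrow> ((nat \<Rightarrow> real) \<Rightarrow> real) \<Rightarrow> bool" where
  "Cr_on r n S g \<longleftrightarrow>
    (case r of
       C_top \<Rightarrow> Ck_on 0 n S g
     | C_fin k \<Rightarrow> Ck_on k n S g
     | C_inf \<Rightarrow> (\<forall>k. Ck_on k n S g)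
     | C_an \<Rightarrow> analytic_fun_on n S g)"

text \<open>A map on an arbitrary subset \<open>S\<close> of \<open>\<real>\<^sup>n\<close> is \<open>C\<^sup>r\<close> if it extends locally to \<open>C\<^sup>r\<close> maps on open
  sets; for open \<open>S\<close> this is the usual notion. Only the first \<open>m\<close> coordinates of the values matter.\<close>

definition Cr_map :: "diffclass \<Rightarrow> nat \<Rightarrow> nat \<Rightarrow> (nat \<Rightarrow> real) set \<Rightarrow>
    ((nat \<Rightarrow> real) \<Rightarrow> (nat \<Rightarrow> real)) \<Rightarrow> bool" where
  "Cr_map r n m S f \<longleftrightarrow>
    (\<forall>p\<in>S. \<exists>O' F. openin (Euclidean_space n) O' \<and> p \<in> O' \<and>
       (\<forall>i<m. Cr_on r n O' (\<lambda>x. F x i)) \<and>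
       (\<forall>x\<in>O' \<inter> S. \<forall>i<m. F x i = f x i))"


section \<open>Manifolds, submanifolds, smooth maps\<close>

text \<open>A chart \<open>(U, n, \<phi>)\<close> has domain \<open>U\<close> and takes values in \<open>\<real>\<^sup>n\<close>; \<open>\<phi>\<close> is irrelevant outside \<open>U\<close>.
  The dimension is allowed to depend on the chart.\<close>

type_synonym 'a chart = "'a set \<times> nat \<times> ('a \<Rightarrow> nat \<Rightarrow> real)"

record 'a mfd =
  mtop :: "'a topology"
  atlas :: "'a chart set"

definition is_chart :: "'a topology \<Rightarrow> 'a chart \<Rightarrow> bool" where
  "is_chart T c \<longleftrightarrow>
    (case c of (U, n, \<phi>) \<Rightarrow>
       openin T U \<and> openin (Euclidean_space n) (\<phi> ` U) \<and>
       homeomorphic_map (subtopology T U) (subtopology (Euclidean_space n) (\<phi> ` U)) \<phi>)"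

definition compatible :: "diffclass \<Rightarrow> 'a chart \<Rightarrow> 'a chart \<Rightarrow> bool" where
  "compatible r c d \<longleftrightarrow>
    (case c of (U, n, \<phi>) \<Rightarrow> case d of (V, m, \<psi>) \<Rightarrow>
       Cr_map r n m (\<phi> ` (U \<inter> V)) (\<psi> \<circ> inv_into U \<phi>) \<and>
       Cr_map r m n (\<psi> ` (U \<inter> V)) (\<phi> \<circ> inv_into V \<psi>))"

text \<open>For \<open>r = -1\<close> a manifold is just a topological space, and the atlas plays no role.\<close>

definition manifold :: "diffclass \<Rightarrow> 'a mfd \<Rightarrow> bool" where
  "manifold r M \<longleftrightarrow> r = C_top \<or>
    (Hausdorff_space (mtop M) \<and> second_countable (mtop M) \<and>
     (\<forall>c\<in>atlas M. is_chart (mtop M) c) \<and>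
     (\<forall>c\<in>atlas M. \<forall>d\<in>atlas M. compatible r c d) \<and>
     (\<Union>(fst ` atlas M) = topspace (mtop M)))"

text \<open>The maximal atlas.\<close>

definition charts :: "diffclass \<Rightarrow> 'a mfd \<Rightarrow> 'a chart set" where
  "charts r M = {c. is_chart (mtop M) c \<and> (\<forall>d\<in>atlas M. compatible r c d)}"

text \<open>Embedded submanifolds, via slice charts; for \<open>r = -1\<close>, arbitrary subspaces.\<close>

definition slice_charts :: "diffclass \<Rightarrow> 'a mfd \<Rightarrow> 'a set \<Rightarrow> 'a chart set" where
  "slice_charts r M A =
    {(U \<inter> A, k, \<phi>) | U n k \<phi>. (U, n, \<phi>) \<in> charts r M \<and> k \<le> n \<and>
       \<phi> ` (U \<inter> A) = \<phi> ` U \<inter> topspace (Euclidean_space k)}"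

definition submanifold :: "diffclass \<Rightarrow> 'a mfd \<Rightarrow> 'a set \<Rightarrow> bool" where
  "submanifold r M A \<longleftrightarrow>
    A \<subseteq> topspace (mtop M) \<and>
    (r \<noteq> C_top \<longrightarrow> A \<subseteq> \<Union>(fst ` slice_charts r M A))"

text \<open>The manifold structure carried by a submanifold.\<close>

definition submfd :: "diffclass \<Rightarrow> 'a mfd \<Rightarrow> 'a set \<Rightarrow> 'a mfd" where
  "submfd r M A = \<lparr>mtop = subtopology (mtop M) A, atlas = slice_charts r M A\<rparr>"

definition prod_mfd :: "'a mfd \<Rightarrow> 'b mfd \<Rightarrow> ('a \<times> 'b) mfd" where
  "prod_mfd M N =
    \<lparr>mtop = prod_topology (mtop M) (mtop N),
     atlas = {(U \<times> V, n + m, \<lambda>(x, y) i. if i < n then \<phi> x i else \<psi> y (i - n)) | U n \<phi> V m \<psi>.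
       (U, n, \<phi>) \<in> atlas M \<and> (V, m, \<psi>) \<in> atlas N}\<rparr>"

text \<open>\<open>smooth_on r M A N f\<close>: the restriction of \<open>f\<close> to \<open>A \<subseteq> M\<close> is a smooth map into \<open>N\<close>. For
  \<open>r \<le> 0\<close> this is continuity. For \<open>r \<ge> 1\<close> and \<open>A\<close> an open subset of a submanifold of \<open>M\<close> it is
  smoothness for the manifold structure that \<open>A\<close> inherits, by local extendability.\<close>

definition smooth_on :: "diffclass \<Rightarrow> 'a mfd \<Rightarrow> 'a set \<Rightarrow> 'b mfd \<Rightarrow> ('a \<Rightarrow> 'b) \<Rightarrow> bool" where
  "smooth_on r M A N f \<longleftrightarrow>
    A \<subseteq> topspace (mtop M) \<and>
    continuous_map (subtopology (mtop M) A) (mtop N) f \<and>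
    (r \<noteq> C_top \<and> r \<noteq> C_fin 0 \<longrightarrow>
      (\<forall>(U, n, \<phi>)\<in>atlas M. \<forall>(V, m, \<psi>)\<in>atlas N.
         Cr_map r n m (\<phi> ` {x \<in> A \<inter> U. f x \<in> V}) (\<psi> \<circ> f \<circ> inv_into U \<phi>)))"

definition smooth_map :: "diffclass \<Rightarrow> 'a mfd \<Rightarrow> 'b mfd \<Rightarrow> ('a \<Rightarrow> 'b) \<Rightarrow> bool" where
  "smooth_map r M N f \<longleftrightarrow> smooth_on r M (topspace (mtop M)) N f"

definition diffeo_on :: "diffclass \<Rightarrow> 'a mfd \<Rightarrow> 'a set \<Rightarrow> 'b mfd \<Rightarrow> 'b set \<Rightarrow> ('a \<Rightarrow> 'b) \<Rightarrow> bool" where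
  "diffeo_on r M A N B f \<longleftrightarrow>
    bij_betw f A B \<and> smooth_on r M A N f \<and> smooth_on r N B M (inv_into A f)"

text \<open>A submersion looks like a coordinate projection \<open>\<real>\<^sup>n \<rightarrow> \<real>\<^sup>m\<close> in suitable charts; this makes sense for
  all \<open>r \<ge> 0\<close>. For \<open>r = -1\<close> nothing is demanded beyond smoothness, so that Lie groupoids of class
  \<open>C\<^sup>-\<^sup>1\<close> are exactly the topological groupoids.\<close>

definition submersion :: "diffclass \<Rightarrow> 'a mfd \<Rightarrow> 'b mfd \<Rightarrow> ('a \<Rightarrow> 'b) \<Rightarrow> bool" where
  "submersion r M N f \<longleftrightarrow>
    smooth_map r M N f \<and>
    (r \<noteq> C_top \<longrightarrow>
      (\<forall>p\<in>topspace (mtop M). \<exists>U n \<phi> V m \<psi>.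
         (U, n, \<phi>) \<in> charts r M \<and> (V, m, \<psi>) \<in> charts r N \<and> p \<in> U \<and> f ` U \<subseteq> V \<and> m \<le> n \<and>
         (\<forall>x\<in>U. \<psi> (f x) = (\<lambda>i. if i < m then \<phi> x i else 0))))"


section \<open>Groupoids\<close>

text \<open>Objects are identified with identity arrows. The product \<open>gmul G u v\<close> is meaningful when
  \<open>tgt G u = src G v\<close>.\<close>

record 'a gpd =
  arrows :: "'a set"
  src :: "'a \<Rightarrow> 'a"
  tgt :: "'a \<Rightarrow> 'a"
  gmul :: "'a \<Rightarrow> 'a \<Rightarrow> 'a"
  ginv :: "'a \<Rightarrow> 'a"

definition objs :: "'a gpd \<Rightarrow> 'a set" where
  "objs G = src G ` arrows G"

locale groupoid =
  fixes G :: "'a gpd"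
  assumes src_closed: "g \<in> arrows G \<Longrightarrow> src G g \<in> arrows G"
    and tgt_closed: "g \<in> arrows G \<Longrightarrow> tgt G g \<in> arrows G"
    and src_src: "g \<in> arrows G \<Longrightarrow> src G (src G g) = src G g"
    and tgt_src: "g \<in> arrows G \<Longrightarrow> tgt G (src G g) = src G g"
    and src_tgt: "g \<in> arrows G \<Longrightarrow> src G (tgt G g) = tgt G g"
    and tgt_tgt: "g \<in> arrows G \<Longrightarrow> tgt G (tgt G g) = tgt G g"
    and mul_closed: "\<lbrakk>u \<in> arrows G; v \<in> arrows G; tgt G u = src G v\<rbrakk> \<Longrightarrow> gmul G u v \<in> arrows G"
    and src_mul: "\<lbrakk>u \<in> arrows G; v \<in> arrows G; tgt G u = src G v\<rbrakk> \<Longrightarrow> src G (gmul G u v) = src G u"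
    and tgt_mul: "\<lbrakk>u \<in> arrows G; v \<in> arrows G; tgt G u = src G v\<rbrakk> \<Longrightarrow> tgt G (gmul G u v) = tgt G v"
    and mul_assoc: "\<lbrakk>u \<in> arrows G; v \<in> arrows G; w \<in> arrows G; tgt G u = src G v; tgt G v = src G w\<rbrakk>
      \<Longrightarrow> gmul G (gmul G u v) w = gmul G u (gmul G v w)"
    and mul_src: "g \<in> arrows G \<Longrightarrow> gmul G (src G g) g = g"
    and mul_tgt: "g \<in> arrows G \<Longrightarrow> gmul G g (tgt G g) = g"
    and inv_closed: "g \<in> arrows G \<Longrightarrow> ginv G g \<in> arrows G"
    and src_inv: "g \<in> arrows G \<Longrightarrow> src G (ginv G g) = tgt G g"
    and tgt_inv: "g \<in> arrows G \<Longrightarrow> tgt G (ginv G g) = src G g"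
    and mul_inv: "g \<in> arrows G \<Longrightarrow> gmul G g (ginv G g) = src G g"
    and inv_mul: "g \<in> arrows G \<Longrightarrow> gmul G (ginv G g) g = tgt G g"

definition subgroupoid :: "'a gpd \<Rightarrow> 'a set \<Rightarrow> bool" where
  "subgroupoid G H \<longleftrightarrow>
    H \<subseteq> arrows G \<and> src G ` H \<subseteq> H \<and> tgt G ` H \<subseteq> H \<and> ginv G ` H \<subseteq> H \<and>
    (\<forall>u\<in>H. \<forall>v\<in>H. tgt G u = src G v \<longrightarrow> gmul G u v \<in> H)"

definition wide_subgroupoid :: "'a gpd \<Rightarrow> 'a set \<Rightarrow> bool" where
  "wide_subgroupoid G H \<longleftrightarrow> subgroupoid G H \<and> objs G \<subseteq> H"

definition sub_gpd :: "'a gpd \<Rightarrow> 'a set \<Rightarrow> 'a gpd" where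
  "sub_gpd G H = G\<lparr>arrows := H\<rparr>"

definition generated_subgroupoid :: "'a gpd \<Rightarrow> 'a set \<Rightarrow> 'a set" where
  "generated_subgroupoid G A = \<Inter>{H. subgroupoid G H \<and> A \<subseteq> H}"

text \<open>For \<open>A \<subseteq> G\<close>: the set \<open>A \<times>\<^sub>\<alpha> A\<close>, the difference map \<open>\<delta>\<close>, and \<open>A(\<delta>)\<close>.\<close>

definition src_pairs :: "'a gpd \<Rightarrow> 'a set \<Rightarrow> ('a \<times> 'a) set" where
  "src_pairs G A = {(g, h). g \<in> A \<and> h \<in> A \<and> src G g = src G h}"

definition delta :: "'a gpd \<Rightarrow> 'a \<times> 'a \<Rightarrow> 'a" where
  "delta G = (\<lambda>(g, h). gmul G (ginv G g) h)"

definition delta_dom :: "'a gpd \<Rightarrow> 'a set \<Rightarrow> ('a \<times> 'a) set" where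
  "delta_dom G A = {p \<in> src_pairs G A. delta G p \<in> A}"


section \<open>Lie groupoids and locally Lie groupoids\<close>

definition topological_groupoid :: "'a gpd \<Rightarrow> 'a topology \<Rightarrow> bool" where
  "topological_groupoid G T \<longleftrightarrow>
    groupoid G \<and> topspace T = arrows G \<and>
    continuous_map T (subtopology T (objs G)) (src G) \<and>
    continuous_map T (subtopology T (objs G)) (tgt G) \<and>
    continuous_map T T (ginv G) \<and>
    continuous_map
      (subtopology (prod_topology T T) {(u, v). u \<in> arrows G \<and> v \<in> arrows G \<and> tgt G u = src G v})
      T (\<lambda>(u, v). gmul G u v)"

definition lie_groupoid :: "diffclass \<Rightarrow> 'a gpd \<Rightarrow> 'a mfd \<Rightarrow> bool" where
  "lie_groupoid r G M \<longleftrightarrow>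
    topological_groupoid G (mtop M) \<and>
    manifold r M \<and> submanifold r M (objs G) \<and>
    submersion r M (submfd r M (objs G)) (src G) \<and>
    submersion r M (submfd r M (objs G)) (tgt G) \<and>
    submanifold r (prod_mfd M M) (src_pairs G (arrows G)) \<and>
    smooth_on r (prod_mfd M M) (src_pairs G (arrows G)) M (delta G)"

text \<open>\<open>N\<close> is the manifold of objects of \<open>G\<close>.\<close>

definition admissible_local_section ::
    "diffclass \<Rightarrow> 'a gpd \<Rightarrow> 'a mfd \<Rightarrow> 'a set \<Rightarrow> ('a \<Rightarrow> 'a) \<Rightarrow> bool" where
  "admissible_local_section r G N U \<sigma> \<longleftrightarrow>
    openin (mtop N) U \<and> \<sigma> ` U \<subseteq> arrows G \<and> (\<forall>x\<in>U. src G (\<sigma> x) = x) \<and>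
    openin (mtop N) ((tgt G \<circ> \<sigma>) ` U) \<and>
    diffeo_on r N U N ((tgt G \<circ> \<sigma>) ` U) (tgt G \<circ> \<sigma>)"

text \<open>\<open>W\<close> is a manifold whose underlying set is a subset of \<open>G\<close>.\<close>

definition locally_sectionable :: "diffclass \<Rightarrow> 'a gpd \<Rightarrow> 'a mfd \<Rightarrow> bool" where
  "locally_sectionable r G W \<longleftrightarrow>
    submanifold r W (objs G) \<and>
    (\<forall>w\<in>topspace (mtop W). \<exists>U \<sigma>.
       admissible_local_section r G (submfd r W (objs G)) U \<sigma> \<and>
       src G w \<in> U \<and> \<sigma> (src G w) = w \<and> \<sigma> ` U \<subseteq> topspace (mtop W) \<and>
       smooth_on r (submfd r W (objs G)) U W \<sigma>)"

definition locally_lie_groupoid :: "diffclass \<Rightarrow> 'a gpd \<Rightarrow> 'a mfd \<Rightarrow> bool" where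
  "locally_lie_groupoid r G WM \<longleftrightarrow>
    (let W = topspace (mtop WM) in
     groupoid G \<and> manifold r WM \<and>
     objs G \<subseteq> W \<and> W \<subseteq> arrows G \<and>
     W = ginv G ` W \<and>
     openin (subtopology (prod_topology (mtop WM) (mtop WM)) (src_pairs G W)) (delta_dom G W) \<and>
     smooth_on r (prod_mfd WM WM) (delta_dom G W) WM (delta G) \<and>
     smooth_map r WM (submfd r WM (objs G)) (src G) \<and>
     smooth_map r WM (submfd r WM (objs G)) (tgt G) \<and>
     locally_sectionable r G WM \<and>
     generated_subgroupoid G W = arrows G)"


section \<open>Local subgroupoids\<close>

text \<open>Here \<open>Q\<close> is a groupoid and \<open>T\<close> a topology on its set of objects. The restriction \<open>H|V\<close>:\<close>

definition restr :: "'a gpd \<Rightarrow> 'a set \<Rightarrow> 'a set \<Rightarrow> 'a set" where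
  "restr Q H V = {g \<in> H. src Q g \<in> V \<and> tgt Q g \<in> V}"

definition LQ :: "'a gpd \<Rightarrow> 'a set \<Rightarrow> 'a set set" where
  "LQ Q U = {H. wide_subgroupoid (sub_gpd Q (restr Q (arrows Q) U)) H}"

type_synonym 'a germ = "('a set \<times> 'a set) set"

definition germ :: "'a gpd \<Rightarrow> 'a topology \<Rightarrow> 'a \<Rightarrow> 'a set \<Rightarrow> 'a set \<Rightarrow> 'a germ" where
  "germ Q T x U H =
    {(V, K). openin T V \<and> x \<in> V \<and> K \<in> LQ Q V \<and>
       (\<exists>W. openin T W \<and> x \<in> W \<and> W \<subseteq> U \<inter> V \<and> restr Q H W = restr Q K W)}"

text \<open>Global sections of the associated sheaf.\<close>

definition local_subgroupoid :: "'a gpd \<Rightarrow> 'a topology \<Rightarrow> ('a \<Rightarrow> 'a germ) \<Rightarrow> bool" where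
  "local_subgroupoid Q T s \<longleftrightarrow>
    (\<forall>x\<in>topspace T. \<exists>U H. openin T U \<and> x \<in> U \<and> H \<in> LQ Q U \<and> (\<forall>y\<in>U. s y = germ Q T y U H))"

definition germ_le :: "'a gpd \<Rightarrow> 'a topology \<Rightarrow> 'a \<Rightarrow> 'a germ \<Rightarrow> 'a germ \<Rightarrow> bool" where
  "germ_le Q T x a b \<longleftrightarrow>
    (\<exists>(U', H')\<in>a. \<exists>(U, H)\<in>b. \<exists>W. openin T W \<and> x \<in> W \<and> W \<subseteq> U \<inter> U' \<and>
       restr Q H' W \<subseteq> restr Q H W)"

definition local_le :: "'a gpd \<Rightarrow> 'a topology \<Rightarrow> ('a \<Rightarrow> 'a germ) \<Rightarrow> ('a \<Rightarrow> 'a germ) \<Rightarrow> bool" where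
  "local_le Q T s t \<longleftrightarrow> (\<forall>x\<in>topspace T. germ_le Q T x (s x) (t x))"

definition loc :: "'a gpd \<Rightarrow> 'a topology \<Rightarrow> 'a set \<Rightarrow> 'a \<Rightarrow> 'a germ" where
  "loc Q T H = (\<lambda>x. germ Q T x (topspace T) H)"

definition glob :: "'a gpd \<Rightarrow> 'a topology \<Rightarrow> ('a \<Rightarrow> 'a germ) \<Rightarrow> 'a set" where
  "glob Q T s = \<Inter>{H. wide_subgroupoid Q H \<and> local_le Q T s (loc Q T H)}"

text \<open>An atlas \<open>{(U\<^sub>i, H\<^sub>i) : i \<in> I}\<close> is represented by this set of pairs.\<close>

definition local_atlas :: "'a gpd \<Rightarrow> 'a topology \<Rightarrow> ('a set \<times> 'a set) set \<Rightarrow> ('a \<Rightarrow> 'a germ) \<Rightarrow> bool" where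
  "local_atlas Q T \<U> s \<longleftrightarrow>
    (\<Union>(U, H)\<in>\<U>. U) = topspace T \<and>
    (\<forall>(U, H)\<in>\<U>. openin T U \<and> H \<in> LQ Q U \<and> (\<forall>x\<in>U. s x = germ Q T x U H))"

definition globally_adapted ::
    "'a gpd \<Rightarrow> 'a topology \<Rightarrow> ('a set \<times> 'a set) set \<Rightarrow> ('a \<Rightarrow> 'a germ) \<Rightarrow> bool" where
  "globally_adapted Q T \<U> s \<longleftrightarrow> glob Q T s = generated_subgroupoid Q (\<Union>(U, H)\<in>\<U>. H)"


section \<open>Lie local subgroupoids\<close>

definition obj_top :: "'a gpd \<Rightarrow> 'a mfd \<Rightarrow> 'a topology" where
  "obj_top Q M = subtopology (mtop M) (objs Q)"

definition lie_subgroupoid :: "diffclass \<Rightarrow> 'a gpd \<Rightarrow> 'a mfd \<Rightarrow> 'a set \<Rightarrow> bool" where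
  "lie_subgroupoid r Q M H \<longleftrightarrow>
    subgroupoid Q H \<and> submanifold r M H \<and> lie_groupoid r (sub_gpd Q H) (submfd r M H)"

definition lie_atlas :: "diffclass \<Rightarrow> 'a gpd \<Rightarrow> 'a mfd \<Rightarrow> ('a set \<times> 'a set) set \<Rightarrow> ('a \<Rightarrow> 'a germ) \<Rightarrow> bool" where
  "lie_atlas r Q M \<U> s \<longleftrightarrow>
    local_atlas Q (obj_top Q M) \<U> s \<and> (\<forall>(U, H)\<in>\<U>. lie_subgroupoid r Q M H)"

definition lie_local_subgroupoid :: "diffclass \<Rightarrow> 'a gpd \<Rightarrow> 'a mfd \<Rightarrow> ('a \<Rightarrow> 'a germ) \<Rightarrow> bool" where
  "lie_local_subgroupoid r Q M s \<longleftrightarrow>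
    local_subgroupoid Q (obj_top Q M) s \<and> (\<exists>\<U>. lie_atlas r Q M \<U> s)"

definition regular_atlas :: "diffclass \<Rightarrow> 'a gpd \<Rightarrow> 'a mfd \<Rightarrow> ('a set \<times> 'a set) set \<Rightarrow> ('a \<Rightarrow> 'a germ) \<Rightarrow> bool" where
  "regular_atlas r Q M \<U> s \<longleftrightarrow>
    lie_atlas r Q M \<U> s \<and>
    (\<forall>(U, H)\<in>\<U>. locally_sectionable r (sub_gpd Q H) (submfd r M H))"

text \<open>In the last clause, \<open>H\<close> being open in \<open>W\<close> suffices for it to be an open submanifold of \<open>W\<close>: both
  structures are induced from \<open>M\<close>.\<close>

definition strictly_regular_atlas ::
    "diffclass \<Rightarrow> 'a gpd \<Rightarrow> 'a mfd \<Rightarrow> ('a set \<times> 'a set) set \<Rightarrow> ('a \<Rightarrow> 'a germ) \<Rightarrow> bool" where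
  "strictly_regular_atlas r Q M \<U> s \<longleftrightarrow>
    globally_adapted Q (obj_top Q M) \<U> s \<and>
    regular_atlas r Q M \<U> s \<and>
    (let W = (\<Union>(U, H)\<in>\<U>. H); T = subtopology (mtop M) W in
     submanifold r M W \<and>
     (\<forall>(U, H)\<in>\<U>. openin T H) \<and>
     openin (subtopology (prod_topology T T) (src_pairs Q W)) (delta_dom Q W))"

end

theory Submission
  imports Defs
begin

text \<open>
  Put \<open>W = \<Union>\<^sub>i H\<^sub>i\<close>. Since the atlas is globally adapted, \<open>G = glob(s)\<close> is the subgroupoid of \<open>Q\<close> generated
  by \<open>W\<close>. Each \<open>H\<^sub>i\<close> is a subgroupoid with all of \<open>U\<^sub>i\<close> as objects, and the \<open>U\<^sub>i\<close> cover the objects of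
  \<open>Q\<close>; so \<open>W\<close> contains the objects and is closed under inversion, and the algebraic conditions on
  \<open>(G, W)\<close> follow. Openness of \<open>W(\<delta>)\<close> is part of strict regularity.

  The smoothness conditions are inherited. The maps \<open>\<alpha>\<close>, \<open>\<beta>\<close> and \<open>\<delta>\<close> of \<open>W\<close> are restrictions of those of
  \<open>Q\<close>, which are smooth for the manifold \<open>Q\<close>, and local sections are taken from the \<open>H\<^sub>i\<close>, which are open
  in \<open>W\<close>. What has to be proved is that restricting a smooth map to submanifolds keeps it smooth for
  the structures given by slice charts. Such a restriction is a composite with inclusions
  \<open>S \<rightarrow> M\<close> and corestrictions \<open>M \<rightarrow> S\<close>, both of which are smooth because slice charts belong to the maximal
  atlas of \<open>M\<close> (\<open>smooth_on_inclusion\<close>, \<open>smooth_on_corestrict\<close>). The same factorization shows that a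
  submanifold is a manifold (\<open>manifold_submfd\<close>) and that different ways of making the objects
  a manifold agree (\<open>smooth_on_id_nested\<close>).

  Everything thus rests on the fact that smooth maps compose (\<open>smooth_on_compose\<close>), which comes down to the
  composition of \<open>C\<^sup>r\<close> maps between subsets of Euclidean spaces (\<open>Cr_map_compose\<close>). For finite \<open>r\<close> and
  \<open>r = \<infinity>\<close> this is the chain rule in several variables (\<open>Ck_on_compose\<close>). For \<open>r = \<omega>\<close> it is
  substitution of power series (\<open>analytic_compose\<close>), carried out in the Banach algebra of power series
  with a weighted \<open>\<ell>\<^sup>1\<close>-norm.
\<close>

section \<open>Cubes and continuity in Euclidean space\<close>

definition cube :: "nat \<Rightarrow> (nat \<Rightarrow> real) \<Rightarrow> real \<Rightarrow> (nat \<Rightarrow> real) set" where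
  "cube n p e = {y \<in> topspace (Euclidean_space n). \<forall>i<n. \<bar>y i - p i\<bar> \<le> e}"

lemma cube_mono: "d \<le> e \<Longrightarrow> cube n p d \<subseteq> cube n p e"
  unfolding cube_def by force

lemma center_in_cube: "p \<in> topspace (Euclidean_space n) \<Longrightarrow> 0 \<le> e \<Longrightarrow> p \<in> cube n p e"
  unfolding cube_def by simp

lemma ex_common_radius:
  fixes P :: "nat \<Rightarrow> real \<Rightarrow> bool"
  assumes "\<And>i. i < n \<Longrightarrow> \<exists>e>0. P i e"
    and mono: "\<And>i d e. P i e \<Longrightarrow> 0 < d \<Longrightarrow> d \<le> e \<Longrightarrow> P i d"
  shows "\<exists>e>0. \<forall>i<n. P i e"
  using assms(1)
proof (induction n)
  case 0
  show ?case by (auto intro: exI[of _ 1])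
next
  case (Suc n)
  then obtain e where e: "e > 0" "\<forall>i<n. P i e" by auto
  obtain d where d: "d > 0" "P n d" using Suc.prems by auto
  have "\<forall>i<Suc n. P i (min d e)"
    using e d mono by (auto simp: less_Suc_eq)
  then show ?case using e d by (intro exI[of _ "min d e"]) auto
qed

text \<open>The topology of \<open>\<real>\<^sup>n\<close> comes from an infinite product, but all coordinates from \<open>n\<close> on are \<open>0\<close>, so
  that only finitely many coordinates have a say in the radius.\<close>

lemma cube_subset_open:
  assumes "openin (Euclidean_space n) S" "p \<in> S"
  shows "\<exists>e>0. cube n p e \<subseteq> S"
proof -
  obtain T where T: "openin (powertop_real UNIV) T" "S = T \<inter> {x. \<forall>i\<ge>n. x i = 0}"
    using assms(1) unfolding Euclidean_space_def openin_subtopology by blast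
  obtain A where A: "p \<in> Pi\<^sub>E UNIV A" "\<forall>i. openin euclideanreal (A i)" "Pi\<^sub>E UNIV A \<subseteq> T"
    using T assms(2) by (force simp: openin_product_topology_alt)
  have "\<exists>e>0. \<forall>t. \<bar>t - p i\<bar> \<le> e \<longrightarrow> t \<in> A i" for i
  proof -
    have "open (A i)" "p i \<in> A i" using A by auto
    then obtain e where "e > 0" "cball (p i) e \<subseteq> A i" using open_contains_cball by blast
    then show ?thesis by (intro exI[of _ e]) (auto simp: subset_iff dist_real_def abs_minus_commute)
  qed
  then obtain e where e: "e > 0" "\<forall>i<n. \<forall>t. \<bar>t - p i\<bar> \<le> e \<longrightarrow> t \<in> A i"
    using ex_common_radius[of n "\<lambda>i e. \<forall>t. \<bar>t - p i\<bar> \<le> e \<longrightarrow> t \<in> A i"] by force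
  have "y \<in> S" if y: "y \<in> cube n p e" for y
  proof -
    have "y i \<in> A i" for i
    proof (cases "i < n")
      case True then show ?thesis using y e by (auto simp: cube_def)
    next
      case False
      then have "y i = p i" using y assms(2) T by (auto simp: cube_def topspace_Euclidean_space)
      then show ?thesis using A by auto
    qed
    then show ?thesis using A T y by (auto simp: cube_def topspace_Euclidean_space)
  qed
  with e show ?thesis by blast
qed

lemma continuous_map_coordinate: "continuous_map (Euclidean_space n) euclideanreal (\<lambda>x. x i)"
  unfolding Euclidean_space_def
  by (intro continuous_map_from_subtopology) (metis UNIV_I continuous_map_product_coordinates)

lemma open_cube:
  assumes "k \<le> n"
  shows "openin (Euclidean_space n) {y \<in> topspace (Euclidean_space n). \<forall>i<k. \<bar>y i - p i\<bar> < e}"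
  using assms
proof (induction k)
  case 0
  then show ?case by simp
next
  case (Suc k)
  have "continuous_map (Euclidean_space n) euclideanreal (\<lambda>y. \<bar>y k - p k\<bar>)"
    by (intro continuous_intros continuous_map_coordinate)
  then have "openin (Euclidean_space n) {y \<in> topspace (Euclidean_space n). \<bar>y k - p k\<bar> \<in> {..<e}}"
    by (rule openin_continuous_map_preimage) simp
  with Suc have "openin (Euclidean_space n) ({y \<in> topspace (Euclidean_space n). \<forall>i<k. \<bar>y i - p i\<bar> < e}
     \<inter> {y \<in> topspace (Euclidean_space n). \<bar>y k - p k\<bar> \<in> {..<e}})" by (intro openin_Int) auto
  also have "\<dots> = {y \<in> topspace (Euclidean_space n). \<forall>i<Suc k. \<bar>y i - p i\<bar> < e}"
    by (auto simp: less_Suc_eq)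
  finally show ?case .
qed

lemma openin_Euclidean_space_cubes:
  "openin (Euclidean_space n) S \<longleftrightarrow>
    S \<subseteq> topspace (Euclidean_space n) \<and> (\<forall>p\<in>S. \<exists>e>0. cube n p e \<subseteq> S)"
proof (intro iffI conjI ballI)
  assume "S \<subseteq> topspace (Euclidean_space n) \<and> (\<forall>p\<in>S. \<exists>e>0. cube n p e \<subseteq> S)"
  then have S: "S \<subseteq> topspace (Euclidean_space n)" "\<And>p. p \<in> S \<Longrightarrow> \<exists>e>0. cube n p e \<subseteq> S" by auto
  show "openin (Euclidean_space n) S"
  proof (subst openin_subopen, intro ballI)
    fix p assume p: "p \<in> S"
    then obtain e where e: "e > 0" "cube n p e \<subseteq> S" using S by blast
    let ?T = "{y \<in> topspace (Euclidean_space n). \<forall>i<n. \<bar>y i - p i\<bar> < e}"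
    have "?T \<subseteq> cube n p e" unfolding cube_def by force
    then show "\<exists>T. openin (Euclidean_space n) T \<and> p \<in> T \<and> T \<subseteq> S"
      using open_cube[of n n p e] e p S by (intro exI[of _ ?T]) auto
  qed
qed (use cube_subset_open in \<open>auto dest: openin_subset\<close>)

text \<open>The \<open>\<epsilon>\<close>-\<open>\<delta>\<close> criterion. Analysis on \<open>\<real>\<^sup>n\<close> goes through cubes and single coordinates
  below, since the type of real sequences carries no norm.\<close>

lemma continuous_map_cubes:
  assumes "openin (Euclidean_space n) S"
  shows "continuous_map (subtopology (Euclidean_space n) S) euclideanreal g \<longleftrightarrow>
    (\<forall>p\<in>S. \<forall>\<epsilon>>0. \<exists>d>0. cube n p d \<subseteq> S \<and> (\<forall>y\<in>cube n p d. \<bar>g y - g p\<bar> < \<epsilon>))"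
    (is "?L \<longleftrightarrow> ?R")
proof
  have S: "topspace (Euclidean_space n) \<inter> S = S" using openin_subset[OF assms] by blast
  assume L: ?L
  show ?R
  proof (intro ballI allI impI)
    fix p and \<epsilon> :: real assume p: "p \<in> S" "\<epsilon> > 0"
    have "openin (subtopology (Euclidean_space n) S)
        {y \<in> topspace (subtopology (Euclidean_space n) S). g y \<in> ball (g p) \<epsilon>}"
      by (rule openin_continuous_map_preimage[OF L]) simp
    then have "openin (Euclidean_space n) {y \<in> S. g y \<in> ball (g p) \<epsilon>}"
      using openin_open_subtopology[OF assms] by (simp add: S)
    from cube_subset_open[OF this, of p] p
    obtain d where "d > 0" "cube n p d \<subseteq> {y \<in> S. g y \<in> ball (g p) \<epsilon>}" by auto
    then show "\<exists>d>0. cube n p d \<subseteq> S \<and> (\<forall>y\<in>cube n p d. \<bar>g y - g p\<bar> < \<epsilon>)"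
      by (intro exI[of _ d]) (auto simp: dist_real_def abs_minus_commute subset_iff)
  qed
next
  have S: "topspace (Euclidean_space n) \<inter> S = S" using openin_subset[OF assms] by blast
  assume R: ?R
  show ?L
    unfolding continuous_map_def
  proof (intro conjI allI impI)
    fix B assume B: "openin euclideanreal B"
    have "openin (Euclidean_space n) {y \<in> S. g y \<in> B}"
      unfolding openin_Euclidean_space_cubes
    proof (intro conjI ballI)
      show "{y \<in> S. g y \<in> B} \<subseteq> topspace (Euclidean_space n)" using S by blast
      fix p assume p: "p \<in> {y \<in> S. g y \<in> B}"
      then have "open B" "g p \<in> B" using B by auto
      then obtain \<epsilon> where \<epsilon>: "\<epsilon> > 0" "ball (g p) \<epsilon> \<subseteq> B" by (rule openE)
      with R p obtain d where "d > 0" "cube n p d \<subseteq> S" "\<forall>y\<in>cube n p d. \<bar>g y - g p\<bar> < \<epsilon>" by blast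
      then show "\<exists>e>0. cube n p e \<subseteq> {y \<in> S. g y \<in> B}"
        using \<epsilon> by (intro exI[of _ d]) (auto simp: subset_iff dist_real_def abs_minus_commute)
    qed
    then show "openin (subtopology (Euclidean_space n) S) {y \<in> topspace (subtopology (Euclidean_space n) S). g y \<in> B}"
      using openin_open_subtopology[OF assms] by (simp add: S)
  qed auto
qed

lemma continuous_map_into_Euclidean_space:
  assumes "\<And>x. x \<in> topspace X \<Longrightarrow> f x \<in> topspace (Euclidean_space m)"
    and "\<And>i. i < m \<Longrightarrow> continuous_map X euclideanreal (\<lambda>x. f x i)"
  shows "continuous_map X (Euclidean_space m) f"
proof -
  have "continuous_map X (Euclidean_space m) (\<lambda>x i. if i < m then f x i else 0)"
    using assms(2) by (simp add: continuous_map_componentwise_Euclidean_space)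
  then show ?thesis
    by (rule continuous_map_eq) (use assms(1) in \<open>force simp: topspace_Euclidean_space\<close>)
qed

section \<open>The chain rule for functions with continuous partial derivatives\<close>

text \<open>A form of the mean value theorem for both orders of the end points: in the chain rule a curve may
  move in either direction along each coordinate.\<close>

lemma MVT_unordered:
  fixes f :: "real \<Rightarrow> real"
  assumes "a \<noteq> b"
    and "\<And>s. min a b \<le> s \<Longrightarrow> s \<le> max a b \<Longrightarrow> (f has_real_derivative f' s) (at s)"
  shows "\<exists>c. min a b \<le> c \<and> c \<le> max a b \<and> f b - f a = (b - a) * f' c"
proof (cases "a < b")
  case True
  then obtain c where "a < c" "c < b" "f b - f a = (b - a) * f' c"
    using MVT2[of a b f f'] assms(2) by auto
  then show ?thesis using True by (intro exI[of _ c]) auto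
next
  case False
  then have "b < a" using assms(1) by simp
  then obtain c where "b < c" "c < a" "f a - f b = (a - b) * f' c"
    using MVT2[of b a f f'] assms(2) by auto
  then show ?thesis using \<open>b < a\<close> by (intro exI[of _ c]) (auto simp: algebra_simps)
qed

text \<open>Move from \<open>\<gamma> t0\<close> to \<open>\<gamma> t\<close> by changing one coordinate at a time. Along each of these \<open>m\<close> segments the
  mean value theorem applies to the partial derivative in that coordinate, and continuity of the
  partial derivatives lets the intermediate points be replaced by \<open>\<gamma> t0\<close> in the limit.\<close>

lemma chain_rule_along_curve:
  fixes g :: "(nat \<Rightarrow> real) \<Rightarrow> real" and \<gamma> :: "real \<Rightarrow> nat \<Rightarrow> real"
  assumes P: "openin (Euclidean_space m) P" "\<gamma> t0 \<in> P"
    and curve: "\<forall>\<^sub>F t in at t0. \<gamma> t \<in> topspace (Euclidean_space m)"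
    and deriv: "\<And>j. j < m \<Longrightarrow> ((\<lambda>t. \<gamma> t j) has_real_derivative D j) (at t0)"
    and part: "\<And>j x. j < m \<Longrightarrow> x \<in> P \<Longrightarrow> ((\<lambda>t. g (x(j := t))) has_real_derivative g' j x) (at (x j))"
    and cont: "\<And>j. j < m \<Longrightarrow> continuous_map (subtopology (Euclidean_space m) P) euclideanreal (g' j)"
  shows "((\<lambda>t. g (\<gamma> t)) has_real_derivative (\<Sum>j<m. g' j (\<gamma> t0) * D j)) (at t0)"
proof -
  let ?y = "\<gamma> t0"
  \<comment> \<open>\<open>hyb k t\<close> is the point reached after the first \<open>k\<close> coordinates have been changed.\<close>
  define hyb where "hyb k t = (\<lambda>i. if i < k then \<gamma> t i else ?y i)" for k t
  have y: "?y \<in> topspace (Euclidean_space m)" using P openin_subset by blast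
  have near: "\<forall>\<^sub>F t in at t0. \<forall>j<m. \<bar>\<gamma> t j - ?y j\<bar> \<le> d" if "d > 0" for d
  proof -
    have "\<forall>\<^sub>F t in at t0. \<bar>\<gamma> t j - ?y j\<bar> \<le> d" if "j < m" for j
    proof -
      have "((\<lambda>t. \<gamma> t j) \<longlongrightarrow> ?y j) (at t0)"
        using DERIV_isCont[OF deriv[OF that]] by (simp add: isCont_def)
      then have "\<forall>\<^sub>F t in at t0. dist (\<gamma> t j) (?y j) < d" using \<open>d > 0\<close> by (rule tendstoD)
      then show ?thesis by (rule eventually_mono) (simp add: dist_real_def)
    qed
    then have "\<forall>\<^sub>F t in at t0. \<forall>j\<in>{..<m}. \<bar>\<gamma> t j - ?y j\<bar> \<le> d"
      by (intro eventually_ball_finite) auto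
    then show ?thesis by (rule eventually_mono) auto
  qed
  have step: "((\<lambda>t. g (hyb (Suc k) t) - g (hyb k t)) has_real_derivative g' k ?y * D k) (at t0)"
    if k: "k < m" for k
  proof -
    \<comment> \<open>The difference quotient in coordinate \<open>k\<close>, with its limit as value where the coordinate does not
        move at all; the increment of \<open>g\<close> vanishes there.\<close>
    define q where "q t = (if \<gamma> t k = ?y k then g' k ?y
      else (g (hyb (Suc k) t) - g (hyb k t)) / (\<gamma> t k - ?y k))" for t
    have hybSuc: "hyb (Suc k) t = (hyb k t)(k := \<gamma> t k)" for t
      unfolding hyb_def by (auto simp: less_Suc_eq)
    have hybk: "(hyb k t)(k := ?y k) = hyb k t" for t
      unfolding hyb_def by auto
    have quot: "(g (hyb (Suc k) t) - g (hyb k t)) / (t - t0) = q t * ((\<gamma> t k - ?y k) / (t - t0))" for t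
      using hybSuc[of t] hybk[of t] by (auto simp: q_def)
    have "(q \<longlongrightarrow> g' k ?y) (at t0)"
    proof (rule tendstoI)
      fix \<epsilon> :: real assume "\<epsilon> > 0"
      then obtain d where d: "d > 0" "cube m ?y d \<subseteq> P" "\<forall>z\<in>cube m ?y d. \<bar>g' k z - g' k ?y\<bar> < \<epsilon>"
        using cont[OF k] P unfolding continuous_map_cubes[OF P(1)] by blast
      show "\<forall>\<^sub>F t in at t0. dist (q t) (g' k ?y) < \<epsilon>"
        using near[OF d(1)] curve
      proof eventually_elim
        fix t assume t: "\<forall>j<m. \<bar>\<gamma> t j - ?y j\<bar> \<le> d" and tE: "\<gamma> t \<in> topspace (Euclidean_space m)"
        show "dist (q t) (g' k ?y) < \<epsilon>"
        proof (cases "\<gamma> t k = ?y k")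
          case True then show ?thesis using \<open>\<epsilon> > 0\<close> by (simp add: q_def)
        next
          case False
          have inc: "(hyb k t)(k := s) \<in> cube m ?y d" if "min (?y k) (\<gamma> t k) \<le> s" "s \<le> max (?y k) (\<gamma> t k)" for s
          proof -
            have "\<bar>s - ?y k\<bar> \<le> d" using that t k by (smt (verit, best))
            moreover have "\<bar>\<gamma> t j - ?y j\<bar> \<le> d" if "j < m" for j using t that by auto
            ultimately show ?thesis using tE y k d unfolding cube_def hyb_def topspace_Euclidean_space by auto
          qed
          have der: "((\<lambda>s. g ((hyb k t)(k := s))) has_real_derivative g' k ((hyb k t)(k := s))) (at s)"
            if "min (?y k) (\<gamma> t k) \<le> s" "s \<le> max (?y k) (\<gamma> t k)" for s
            using part[OF k, of "(hyb k t)(k := s)"] inc[OF that] d by auto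
          from False have "?y k \<noteq> \<gamma> t k" by simp
          from MVT_unordered[OF this der] obtain c where c: "min (?y k) (\<gamma> t k) \<le> c" "c \<le> max (?y k) (\<gamma> t k)"
            "g ((hyb k t)(k := \<gamma> t k)) - g ((hyb k t)(k := ?y k)) = (\<gamma> t k - ?y k) * g' k ((hyb k t)(k := c))"
            by blast
          then have "q t = g' k ((hyb k t)(k := c))"
            using False by (simp add: q_def hybSuc hybk)
          then show ?thesis using d inc[OF c(1,2)] by (simp add: dist_real_def)
        qed
      qed
    qed
    moreover have "((\<lambda>t. (\<gamma> t k - ?y k) / (t - t0)) \<longlongrightarrow> D k) (at t0)"
      using deriv[OF k] by (simp add: has_field_derivative_iff)
    ultimately have "((\<lambda>t. q t * ((\<gamma> t k - ?y k) / (t - t0))) \<longlongrightarrow> g' k ?y * D k) (at t0)"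
      by (rule tendsto_mult)
    moreover have "hyb k t0 = ?y" "hyb (Suc k) t0 = ?y" by (auto simp: hyb_def)
    ultimately show ?thesis
      unfolding has_field_derivative_iff by (simp add: quot)
  qed
  have "((\<lambda>t. g (hyb k t)) has_real_derivative (\<Sum>j<k. g' j ?y * D j)) (at t0)" if "k \<le> m" for k
    using that
  proof (induction k)
    case 0
    then show ?case by (simp add: hyb_def)
  next
    case (Suc k)
    from DERIV_add[OF Suc.IH step[of k]] Suc.prems show ?case by (simp add: add.commute)
  qed
  from this[of m] have main: "((\<lambda>t. g (hyb m t)) has_real_derivative (\<Sum>j<m. g' j ?y * D j)) (at t0)" by simp
  have "\<forall>\<^sub>F t in nhds t0. g (hyb m t) = g (\<gamma> t)"
  proof -
    have "\<forall>\<^sub>F t in nhds t0. \<gamma> t \<in> topspace (Euclidean_space m)"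
      using curve y unfolding eventually_nhds_conv_at[of _ t0] by blast
    then show ?thesis
    proof eventually_elim
      fix t assume "\<gamma> t \<in> topspace (Euclidean_space m)"
      then have "hyb m t = \<gamma> t" using y by (auto simp: hyb_def topspace_Euclidean_space)
      then show "g (hyb m t) = g (\<gamma> t)" by simp
    qed
  qed
  from iffD1[OF DERIV_cong_ev[OF refl this refl] main] show ?thesis .
qed

section \<open>Closure properties of the class of \<open>C\<^sup>k\<close> functions\<close>

lemma update_in_open:
  assumes "openin (Euclidean_space n) S" "x \<in> S" "i < n"
  shows "\<forall>\<^sub>F t in nhds (x i). x(i := t) \<in> S"
proof -
  obtain e where e: "e > 0" "cube n x e \<subseteq> S" using cube_subset_open assms by blast
  have "x(i := t) \<in> S" if "dist t (x i) < e" for t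
  proof -
    have "x \<in> topspace (Euclidean_space n)" using assms openin_subset by blast
    then have "x(i := t) \<in> cube n x e"
      using e assms that by (auto simp: cube_def topspace_Euclidean_space dist_real_def)
    then show ?thesis using e by blast
  qed
  then show ?thesis using e eventually_nhds_metric by blast
qed

lemma Ck_on_continuous: "Ck_on k n S g \<Longrightarrow> continuous_map (subtopology (Euclidean_space n) S) euclideanreal g"
  by (cases k) auto

lemma Ck_on_SucD: "Ck_on (Suc k) n S g \<Longrightarrow> Ck_on k n S g"
proof (induction k arbitrary: g)
  case (Suc k)
  have "\<exists>g'. (\<forall>x\<in>S. ((\<lambda>t. g (x(i := t))) has_real_derivative g' x) (at (x i))) \<and> Ck_on k n S g'"
    if i: "i < n" for i
  proof -
    obtain g' where g': "\<forall>x\<in>S. ((\<lambda>t. g (x(i := t))) has_real_derivative g' x) (at (x i))" "Ck_on (Suc k) n S g'"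
      using Suc.prems i unfolding Ck_on.simps(2)[of "Suc k"] by metis
    show ?thesis by (rule exI[of _ g'], rule conjI, rule g', rule Suc.IH, rule g')
  qed
  then show ?case using Ck_on_continuous[OF Suc.prems] by simp
qed (simp add: Ck_on_continuous)

lemma Ck_on_subset: "Ck_on k n S g \<Longrightarrow> S' \<subseteq> S \<Longrightarrow> Ck_on k n S' g"
proof (induction k arbitrary: g)
  case 0
  then show ?case by (auto intro: continuous_map_from_subtopology_mono)
next
  case (Suc k)
  have "\<exists>g'. (\<forall>x\<in>S'. ((\<lambda>t. g (x(i := t))) has_real_derivative g' x) (at (x i))) \<and> Ck_on k n S' g'"
    if "i < n" for i
  proof -
    obtain g' where g': "\<forall>x\<in>S. ((\<lambda>t. g (x(i := t))) has_real_derivative g' x) (at (x i))" "Ck_on k n S g'"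
      using Suc.prems(1) \<open>i < n\<close> by auto
    have "Ck_on k n S' g'" using Suc.IH g'(2) Suc.prems(2) by simp
    moreover have "\<forall>x\<in>S'. ((\<lambda>t. g (x(i := t))) has_real_derivative g' x) (at (x i))"
      using g'(1) Suc.prems(2) by (simp add: subset_iff)
    ultimately show ?thesis by (intro exI[of _ g'] conjI)
  qed
  then show ?case using Suc.prems by (auto intro: continuous_map_from_subtopology_mono)
qed

lemma Ck_on_const: "Ck_on k n S (\<lambda>x. c)"
proof (induction k arbitrary: c)
  case (Suc k)
  then show ?case by (auto intro!: exI[of _ "\<lambda>x. 0"])
qed auto

lemma Ck_on_coordinate: "Ck_on k n S (\<lambda>x. x j)"
proof (cases k)
  case 0
  then show ?thesis by (simp add: continuous_map_from_subtopology continuous_map_coordinate)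
next
  case (Suc l)
  have "\<exists>g'. (\<forall>x\<in>S. ((\<lambda>t. (x(i := t)) j) has_real_derivative g' x) (at (x i))) \<and> Ck_on l n S g'" for i
  proof (cases "i = j")
    case True
    then show ?thesis by (auto intro!: exI[of _ "\<lambda>x. 1"] Ck_on_const)
  next
    case False
    then show ?thesis by (auto intro!: exI[of _ "\<lambda>x. 0"] Ck_on_const)
  qed
  then show ?thesis using Suc by (simp add: continuous_map_from_subtopology continuous_map_coordinate)
qed

lemma Ck_on_add: "Ck_on k n S f \<Longrightarrow> Ck_on k n S g \<Longrightarrow> Ck_on k n S (\<lambda>x. f x + g x)"
proof (induction k arbitrary: f g)
  case 0
  then show ?case by (auto intro: continuous_map_add)
next
  case (Suc k)
  have "\<exists>h'. (\<forall>x\<in>S. ((\<lambda>t. f (x(i := t)) + g (x(i := t))) has_real_derivative h' x) (at (x i))) \<and> Ck_on k n S h'"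
    if i: "i < n" for i
  proof -
    obtain f' g' where "\<forall>x\<in>S. ((\<lambda>t. f (x(i := t))) has_real_derivative f' x) (at (x i))" "Ck_on k n S f'"
      "\<forall>x\<in>S. ((\<lambda>t. g (x(i := t))) has_real_derivative g' x) (at (x i))" "Ck_on k n S g'"
      using Suc.prems i unfolding Ck_on.simps(2) by metis
    then show ?thesis using Suc.IH by (intro exI[of _ "\<lambda>x. f' x + g' x"]) (auto intro: DERIV_add)
  qed
  then show ?case using Suc.prems by (auto intro: continuous_map_add)
qed

lemma Ck_on_mult: "Ck_on k n S f \<Longrightarrow> Ck_on k n S g \<Longrightarrow> Ck_on k n S (\<lambda>x. f x * g x)"
proof (induction k arbitrary: f g)
  case 0
  then show ?case by (auto intro: continuous_map_real_mult)
next
  case (Suc k)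
  have "\<exists>h'. (\<forall>x\<in>S. ((\<lambda>t. f (x(i := t)) * g (x(i := t))) has_real_derivative h' x) (at (x i))) \<and> Ck_on k n S h'"
    if i: "i < n" for i
  proof -
    obtain f' g' where *: "\<forall>x\<in>S. ((\<lambda>t. f (x(i := t))) has_real_derivative f' x) (at (x i))" "Ck_on k n S f'"
      "\<forall>x\<in>S. ((\<lambda>t. g (x(i := t))) has_real_derivative g' x) (at (x i))" "Ck_on k n S g'"
      using Suc.prems i unfolding Ck_on.simps(2) by metis
    have "Ck_on k n S (\<lambda>x. f' x * g x + g' x * f x)"
      using * Ck_on_SucD[OF Suc.prems(1)] Ck_on_SucD[OF Suc.prems(2)] by (intro Ck_on_add Suc.IH)
    moreover have "((\<lambda>t. f (x(i := t)) * g (x(i := t))) has_real_derivative f' x * g x + g' x * f x) (at (x i))"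
      if "x \<in> S" for x
      using DERIV_mult[OF *(1)[rule_format, OF that] *(3)[rule_format, OF that]] by simp
    ultimately show ?thesis by (intro exI[of _ "\<lambda>x. f' x * g x + g' x * f x"] conjI ballI)
  qed
  then show ?case using Suc.prems by (auto intro: continuous_map_real_mult)
qed

lemma Ck_on_sum: "(\<And>j. j < (m::nat) \<Longrightarrow> Ck_on k n S (f j)) \<Longrightarrow> Ck_on k n S (\<lambda>x. \<Sum>j<m. f j x)"
proof (induction m)
  case 0 then show ?case by (simp add: Ck_on_const)
next
  case (Suc m) then show ?case by (simp add: Ck_on_add)
qed

text \<open>Induction on \<open>k\<close>: by the chain rule the partial derivatives of the composite are sums of products of
  partial derivatives of \<open>F\<close> with composites of partial derivatives of \<open>g\<close>, all of which are of
  class \<open>C\<^sup>k\<close> when \<open>F\<close> and \<open>g\<close> are of class \<open>C\<^sup>k\<^sup>+\<^sup>1\<close>.\<close>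

lemma Ck_on_compose:
  assumes P: "openin (Euclidean_space m) P" and S: "openin (Euclidean_space n) S"
    and FP: "\<And>x. x \<in> S \<Longrightarrow> F x \<in> P"
  shows "Ck_on k m P g \<Longrightarrow> (\<And>j. j < m \<Longrightarrow> Ck_on k n S (\<lambda>x. F x j)) \<Longrightarrow> Ck_on k n S (\<lambda>x. g (F x))"
proof (induction k arbitrary: g)
  case 0
  have "continuous_map (subtopology (Euclidean_space n) S) (Euclidean_space m) F"
    using 0 FP openin_subset[OF P] openin_subset[OF S] by (intro continuous_map_into_Euclidean_space) auto
  then have "continuous_map (subtopology (Euclidean_space n) S) (subtopology (Euclidean_space m) P) F"
    using FP by (auto simp: continuous_map_in_subtopology)
  then show ?case using 0 continuous_map_compose[of _ _ F _ g] by (simp add: o_def)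
next
  case (Suc k)
  have cont: "Ck_on k n S (\<lambda>x. h (F x))" if "Ck_on k m P h" for h
    using Suc.IH[OF that] Ck_on_SucD[OF Suc.prems(2)] by blast
  have "\<forall>j. \<exists>h. j < m \<longrightarrow> (\<forall>x\<in>P. ((\<lambda>t. g (x(j := t))) has_real_derivative h x) (at (x j))) \<and> Ck_on k m P h"
    using Suc.prems(1) by simp
  then obtain g' where g': "\<And>j x. j < m \<Longrightarrow> x \<in> P \<Longrightarrow> ((\<lambda>t. g (x(j := t))) has_real_derivative g' j x) (at (x j))"
      "\<And>j. j < m \<Longrightarrow> Ck_on k m P (g' j)" by metis
  have "\<exists>h'. (\<forall>x\<in>S. ((\<lambda>t. g (F (x(i := t)))) has_real_derivative h' x) (at (x i))) \<and> Ck_on k n S h'"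
    if i: "i < n" for i
  proof -
    have "\<forall>j. \<exists>h. j < m \<longrightarrow> (\<forall>x\<in>S. ((\<lambda>t. F (x(i := t)) j) has_real_derivative h x) (at (x i))) \<and> Ck_on k n S h"
      using Suc.prems(2) i by simp
    then obtain F' where F': "\<And>j x. j < m \<Longrightarrow> x \<in> S \<Longrightarrow> ((\<lambda>t. F (x(i := t)) j) has_real_derivative F' j x) (at (x i))"
      "\<And>j. j < m \<Longrightarrow> Ck_on k n S (F' j)" by metis
    define h' where "h' x = (\<Sum>j<m. g' j (F x) * F' j x)" for x
    have "Ck_on k n S h'" unfolding h'_def
      by (intro Ck_on_sum Ck_on_mult cont g' F') auto
    moreover have "((\<lambda>t. g (F (x(i := t)))) has_real_derivative h' x) (at (x i))" if x: "x \<in> S" for x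
    proof -
      have "\<forall>\<^sub>F t in at (x i). F (x(i := t)) \<in> topspace (Euclidean_space m)"
        using update_in_open[OF S x i] unfolding eventually_nhds_conv_at
        by (elim conjE eventually_mono) (use FP openin_subset[OF P] in blast)
      then have "((\<lambda>t. g (F (x(i := t)))) has_real_derivative (\<Sum>j<m. g' j (F (x(i := x i))) * F' j x)) (at (x i))"
        by (intro chain_rule_along_curve[where P = P and \<gamma> = "\<lambda>t. F (x(i := t))"] P Ck_on_continuous[OF g'(2)] g'(1))
           (use FP x F'(1) in simp_all)
      then show ?thesis by (simp add: h'_def)
    qed
    ultimately show ?thesis by (intro exI[of _ h'] conjI ballI)
  qed
  then show ?case using Ck_on_continuous[OF cont[OF Ck_on_SucD[OF Suc.prems(1)]]] by simp
qed

section \<open>Power series with a bounded majorant\<close>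

definition multi_indices :: "nat \<Rightarrow> (nat \<Rightarrow> nat) set" where
  "multi_indices n = {m. \<forall>i\<ge>n. m i = 0}"

definition monomial :: "nat \<Rightarrow> (nat \<Rightarrow> real) \<Rightarrow> (nat \<Rightarrow> nat) \<Rightarrow> real" where
  "monomial n d m = (\<Prod>i<n. d i ^ m i)"

text \<open>The functions given on the closed cube of radius \<open>\<rho>\<close> about \<open>p\<close> by a power series whose weighted
  \<open>\<ell>\<^sup>1\<close>-norm \<open>\<Sum> \<bar>a\<^sub>m\<bar> \<rho>\<^bsup>\<bar>m\<bar>\<^esup>\<close> is at most \<open>K\<close>. With this norm such functions form a Banach algebra,
  which turns substitution of power series into a convergent sum in the algebra. The weight
  \<open>\<rho>\<^bsup>\<bar>m\<bar>\<^esup>\<close> is the monomial at the point with all coordinates \<open>\<rho>\<close>.\<close>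

definition power_series_le ::
    "nat \<Rightarrow> (nat \<Rightarrow> real) \<Rightarrow> real \<Rightarrow> real \<Rightarrow> ((nat \<Rightarrow> real) \<Rightarrow> real) \<Rightarrow> bool" where
  "power_series_le n p \<rho> K f \<longleftrightarrow>
    (\<exists>a. (\<lambda>m. \<bar>a m\<bar> * monomial n (\<lambda>_. \<rho>) m) summable_on multi_indices n \<and>
      (\<Sum>\<^sub>\<infinity>m\<in>multi_indices n. \<bar>a m\<bar> * monomial n (\<lambda>_. \<rho>) m) \<le> K \<and>
      (\<forall>y\<in>cube n p \<rho>. ((\<lambda>m. a m * monomial n (\<lambda>i. y i - p i) m) has_sum f y) (multi_indices n)))"

lemma monomial_add: "monomial n d (\<lambda>i. m i + m' i) = monomial n d m * monomial n d m'"
  by (simp add: monomial_def power_add prod.distrib)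

lemma monomial_zero [simp]: "monomial n d (\<lambda>_. 0) = 1"
  by (simp add: monomial_def)

lemma monomial_pos: "\<rho> > 0 \<Longrightarrow> monomial n (\<lambda>_. \<rho>) m > 0"
  by (simp add: monomial_def prod_pos)

lemma monomial_nonneg: "\<rho> \<ge> 0 \<Longrightarrow> monomial n (\<lambda>_. \<rho>) m \<ge> 0"
  by (simp add: monomial_def prod_nonneg)

lemma abs_monomial_le:
  assumes "\<And>i. i < n \<Longrightarrow> \<bar>d i\<bar> \<le> \<rho>"
  shows "\<bar>monomial n d m\<bar> \<le> monomial n (\<lambda>_. \<rho>) m"
  unfolding monomial_def abs_prod power_abs
  by (intro prod_mono) (auto intro!: power_mono assms)

lemma abs_monomial_le_cube:
  "y \<in> cube n p \<rho> \<Longrightarrow> \<bar>monomial n (\<lambda>i. y i - p i) m\<bar> \<le> monomial n (\<lambda>_. \<rho>) m"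
  by (rule abs_monomial_le) (simp add: cube_def)

lemma monomial_origin:
  assumes "m \<in> multi_indices n" "m \<noteq> (\<lambda>_. 0)"
  shows "monomial n (\<lambda>_. 0) m = 0"
proof -
  obtain i where i: "m i \<noteq> 0" using assms(2) by auto
  then have "i < n" using assms(1) by (force simp: multi_indices_def not_less[symmetric])
  then show ?thesis using i by (auto simp: monomial_def)
qed

text \<open>A nonconstant monomial has degree at least \<open>1\<close>, so shrinking the radius gains one factor \<open>\<delta> / \<rho>\<close>.\<close>

lemma monomial_scale_le:
  assumes "m \<in> multi_indices n" "m \<noteq> (\<lambda>_. 0)" "0 < \<delta>" "\<delta> \<le> \<rho>"
  shows "monomial n (\<lambda>_. \<delta>) m \<le> (\<delta> / \<rho>) * monomial n (\<lambda>_. \<rho>) m"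
proof -
  obtain i where i: "m i \<noteq> 0" using assms(2) by auto
  then have "i < n" using assms(1) by (force simp: multi_indices_def not_less[symmetric])
  then have "m i \<le> (\<Sum>j<n. m j)" by (intro member_le_sum) auto
  then have "(\<delta> / \<rho>) ^ (\<Sum>j<n. m j) \<le> (\<delta> / \<rho>) ^ 1"
    using i assms by (intro power_decreasing) auto
  moreover have "monomial n (\<lambda>_. \<delta>) m = (\<delta> / \<rho>) ^ (\<Sum>j<n. m j) * monomial n (\<lambda>_. \<rho>) m"
    using assms by (simp add: monomial_def power_sum power_divide prod_dividef)
  moreover have "monomial n (\<lambda>_. \<rho>) m \<ge> 0" using assms by (intro monomial_nonneg) simp
  ultimately show ?thesis by (metis mult_right_mono power_one_right)
qed

text \<open>Any absolutely convergent family of monomial terms can be collected into a power series: the terms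
  with the same exponent are summed first, and unconditional convergence allows this regrouping.
  Every construction of power series below is an instance with a suitable index set \<open>J\<close>.\<close>

lemma power_series_leI:
  fixes c :: "'j \<Rightarrow> real" and e :: "'j \<Rightarrow> nat \<Rightarrow> nat"
  assumes \<rho>: "\<rho> > 0" and e: "\<And>j. j \<in> J \<Longrightarrow> e j \<in> multi_indices n"
    and sum: "((\<lambda>j. \<bar>c j\<bar> * monomial n (\<lambda>_. \<rho>) (e j)) has_sum L) J" and L: "L \<le> K"
    and f: "\<And>y. y \<in> cube n p \<rho> \<Longrightarrow> ((\<lambda>j. c j * monomial n (\<lambda>i. y i - p i) (e j)) has_sum f y) J"
  shows "power_series_le n p \<rho> K f"
proof -
  let ?M = "multi_indices n"
  define fib where "fib q = {j \<in> J. e j = q}" for q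
  define a where "a q = infsum c (fib q)" for q
  define b where "b q = (\<Sum>\<^sub>\<infinity>j\<in>fib q. \<bar>c j\<bar>)" for q
  have bij: "bij_betw (\<lambda>j. (e j, j)) J (Sigma ?M fib)"
    by (rule bij_betwI[where g = snd]) (use e in \<open>auto simp: fib_def\<close>)
  have regroup: "((\<lambda>x. h (snd x)) has_sum s) (Sigma ?M fib)" if "(h has_sum s) J" for h :: "'j \<Rightarrow> real" and s
    using has_sum_reindex_bij_betw[OF bij, of "\<lambda>x. h (snd x)" s] that by simp
  have abs_c: "(\<lambda>j. \<bar>c j\<bar>) summable_on fib q" for q
  proof -
    have "(\<lambda>j. \<bar>c j\<bar> * monomial n (\<lambda>_. \<rho>) (e j)) summable_on fib q"
      by (rule summable_on_subset_banach[where A = J]) (use sum in \<open>auto simp: fib_def summable_on_def\<close>)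
    then have "(\<lambda>j. \<bar>c j\<bar> * monomial n (\<lambda>_. \<rho>) q) summable_on fib q"
      by (rule summable_on_cong[THEN iffD1, rotated]) (simp add: fib_def)
    then show ?thesis using monomial_pos[OF \<rho>, of n q] by (subst (asm) summable_on_cmult_left') auto
  qed
  have c_sum: "(c has_sum a q) (fib q)" for q
    using abs_c[of q] abs_summable_summable[of c "fib q"] by (simp add: a_def has_sum_infsum)
  have ab: "\<bar>a q\<bar> \<le> b q" for q
    using norm_infsum_bound[of c "fib q"] abs_c[of q] by (simp add: a_def b_def)
  have major: "((\<lambda>q. b q * monomial n (\<lambda>_. \<rho>) q) has_sum L) ?M"
  proof (rule has_sum_SigmaD[OF regroup[OF sum]])
    fix q assume "q \<in> ?M"
    have "((\<lambda>j. \<bar>c j\<bar> * monomial n (\<lambda>_. \<rho>) q) has_sum b q * monomial n (\<lambda>_. \<rho>) q) (fib q)"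
      using abs_c[of q] by (intro has_sum_cmult_left) (simp add: b_def has_sum_infsum)
    then show "((\<lambda>j. \<bar>c (snd (q, j))\<bar> * monomial n (\<lambda>_. \<rho>) (e (snd (q, j)))) has_sum b q * monomial n (\<lambda>_. \<rho>) q) (fib q)"
      by (rule has_sum_cong[THEN iffD1, rotated]) (simp add: fib_def)
  qed
  have nn: "monomial n (\<lambda>_. \<rho>) q \<ge> 0" for q using monomial_pos[OF \<rho>, of n q] by simp
  have le: "\<bar>a q\<bar> * monomial n (\<lambda>_. \<rho>) q \<le> b q * monomial n (\<lambda>_. \<rho>) q" for q
    using ab nn by (intro mult_right_mono) auto
  have s1: "(\<lambda>q. \<bar>a q\<bar> * monomial n (\<lambda>_. \<rho>) q) summable_on ?M"
    by (rule summable_on_comparison_test[where f = "\<lambda>q. b q * monomial n (\<lambda>_. \<rho>) q"])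
       (use major le nn in \<open>auto simp: summable_on_def\<close>)
  have "(\<Sum>\<^sub>\<infinity>q\<in>?M. \<bar>a q\<bar> * monomial n (\<lambda>_. \<rho>) q) \<le> (\<Sum>\<^sub>\<infinity>q\<in>?M. b q * monomial n (\<lambda>_. \<rho>) q)"
    by (rule infsum_mono[OF s1]) (use major le in \<open>auto simp: summable_on_def\<close>)
  then have s2: "(\<Sum>\<^sub>\<infinity>q\<in>?M. \<bar>a q\<bar> * monomial n (\<lambda>_. \<rho>) q) \<le> K"
    using infsumI[OF major] L by simp
  have "((\<lambda>q. a q * monomial n (\<lambda>i. y i - p i) q) has_sum f y) ?M" if y: "y \<in> cube n p \<rho>" for y
  proof (rule has_sum_SigmaD[OF regroup[OF f[OF y]]])
    fix q assume "q \<in> ?M"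
    have "((\<lambda>j. c j * monomial n (\<lambda>i. y i - p i) q) has_sum a q * monomial n (\<lambda>i. y i - p i) q) (fib q)"
      by (intro has_sum_cmult_left c_sum)
    then show "((\<lambda>j. c (snd (q, j)) * monomial n (\<lambda>i. y i - p i) (e (snd (q, j)))) has_sum
        a q * monomial n (\<lambda>i. y i - p i) q) (fib q)"
      by (rule has_sum_cong[THEN iffD1, rotated]) (simp add: fib_def)
  qed
  then show ?thesis unfolding power_series_le_def using s1 s2 by blast
qed

lemma power_series_leE:
  assumes "power_series_le n p \<rho> K f" "\<rho> > 0"
  obtains a L where "((\<lambda>m. \<bar>a m\<bar> * monomial n (\<lambda>_. \<rho>) m) has_sum L) (multi_indices n)" "0 \<le> L" "L \<le> K"
    "\<And>y. y \<in> cube n p \<rho> \<Longrightarrow> ((\<lambda>m. a m * monomial n (\<lambda>i. y i - p i) m) has_sum f y) (multi_indices n)"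
proof -
  from assms(1) obtain a where a: "(\<lambda>m. \<bar>a m\<bar> * monomial n (\<lambda>_. \<rho>) m) summable_on multi_indices n"
    "(\<Sum>\<^sub>\<infinity>m\<in>multi_indices n. \<bar>a m\<bar> * monomial n (\<lambda>_. \<rho>) m) \<le> K"
    "\<And>y. y \<in> cube n p \<rho> \<Longrightarrow> ((\<lambda>m. a m * monomial n (\<lambda>i. y i - p i) m) has_sum f y) (multi_indices n)"
    unfolding power_series_le_def by blast
  have "0 \<le> (\<Sum>\<^sub>\<infinity>m\<in>multi_indices n. \<bar>a m\<bar> * monomial n (\<lambda>_. \<rho>) m)"
    using monomial_pos[OF assms(2)] by (intro infsum_nonneg) (simp add: less_imp_le)
  then show thesis using that[OF has_sum_infsum[OF a(1)]] a by blast
qed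

lemma power_series_le_abs_le:
  assumes "power_series_le n p \<rho> K f" "\<rho> > 0" "y \<in> cube n p \<rho>"
  shows "\<bar>f y\<bar> \<le> K"
proof -
  obtain a L where a: "((\<lambda>m. \<bar>a m\<bar> * monomial n (\<lambda>_. \<rho>) m) has_sum L) (multi_indices n)" "L \<le> K"
    "\<And>y. y \<in> cube n p \<rho> \<Longrightarrow> ((\<lambda>m. a m * monomial n (\<lambda>i. y i - p i) m) has_sum f y) (multi_indices n)"
    using power_series_leE[OF assms(1,2)] by metis
  have le: "\<bar>a m * monomial n (\<lambda>i. y i - p i) m\<bar> \<le> \<bar>a m\<bar> * monomial n (\<lambda>_. \<rho>) m" for m
    unfolding abs_mult by (intro mult_left_mono abs_monomial_le_cube assms) auto
  have "\<bar>f y\<bar> \<le> L"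
    using norm_infsum_le[OF a(3)[OF assms(3)] a(1)] le by simp
  then show ?thesis using a by simp
qed

lemma power_series_le_mono:
  assumes "power_series_le n p \<rho> K f" "0 < \<delta>" "\<delta> \<le> \<rho>"
  shows "power_series_le n p \<delta> K f"
proof -
  have \<rho>: "\<rho> > 0" using assms by simp
  obtain a L where a: "((\<lambda>m. \<bar>a m\<bar> * monomial n (\<lambda>_. \<rho>) m) has_sum L) (multi_indices n)" "L \<le> K"
    "\<And>y. y \<in> cube n p \<rho> \<Longrightarrow> ((\<lambda>m. a m * monomial n (\<lambda>i. y i - p i) m) has_sum f y) (multi_indices n)"
    using power_series_leE[OF assms(1) \<rho>] by metis
  have le: "\<bar>a m\<bar> * monomial n (\<lambda>_. \<delta>) m \<le> \<bar>a m\<bar> * monomial n (\<lambda>_. \<rho>) m" for m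
    using abs_monomial_le[of n "\<lambda>_. \<delta>" \<rho> m] assms by (intro mult_left_mono) auto
  have s: "(\<lambda>m. \<bar>a m\<bar> * monomial n (\<lambda>_. \<delta>) m) summable_on multi_indices n"
    by (rule summable_on_comparison_test[where f = "\<lambda>m. \<bar>a m\<bar> * monomial n (\<lambda>_. \<rho>) m"])
       (use a le monomial_pos[OF assms(2)] in \<open>auto simp: summable_on_def less_imp_le\<close>)
  have "(\<Sum>\<^sub>\<infinity>m\<in>multi_indices n. \<bar>a m\<bar> * monomial n (\<lambda>_. \<delta>) m) \<le> L"
    unfolding infsumI[OF a(1), symmetric]
    by (rule infsum_mono[OF s]) (use a le in \<open>auto simp: summable_on_def\<close>)
  then show ?thesis unfolding power_series_le_def using s a cube_mono[OF assms(3)] by fastforce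
qed

text \<open>Subtracting the constant term makes the norm small on small cubes, because all remaining terms
  have positive degree. Hence such functions are continuous at the centre, and their increments may
  be substituted into other power series.\<close>

lemma power_series_le_center:
  assumes "power_series_le n p \<rho> K f" "0 < \<delta>" "\<delta> \<le> \<rho>" and p: "p \<in> topspace (Euclidean_space n)"
  shows "power_series_le n p \<delta> ((\<delta> / \<rho>) * K) (\<lambda>y. f y - f p)"
proof -
  have \<rho>: "\<rho> > 0" using assms by simp
  obtain a L where a: "((\<lambda>m. \<bar>a m\<bar> * monomial n (\<lambda>_. \<rho>) m) has_sum L) (multi_indices n)" "L \<le> K"
    "\<And>y. y \<in> cube n p \<rho> \<Longrightarrow> ((\<lambda>m. a m * monomial n (\<lambda>i. y i - p i) m) has_sum f y) (multi_indices n)"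
    using power_series_leE[OF assms(1) \<rho>] by metis
  let ?M = "multi_indices n" and ?z = "(\<lambda>_. 0) :: nat \<Rightarrow> nat"
  have z: "?z \<in> ?M" by (simp add: multi_indices_def)
  have "((\<lambda>m. a m * monomial n (\<lambda>i. p i - p i) m) has_sum f p) ?M"
    using a(3)[of p] center_in_cube[OF p] \<rho> by simp
  moreover have "((\<lambda>m. a m * monomial n (\<lambda>i. p i - p i) m) has_sum a ?z) ?M"
    by (rule has_sum_finite_neutralI[of "{?z}"]) (use z monomial_origin in auto)
  ultimately have fp: "f p = a ?z" by (rule has_sum_unique)
  have le: "\<bar>a m\<bar> * monomial n (\<lambda>_. \<delta>) m \<le> (\<delta> / \<rho>) * (\<bar>a m\<bar> * monomial n (\<lambda>_. \<rho>) m)" if "m \<in> ?M - {?z}" for m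
    using mult_left_mono[OF monomial_scale_le[of m n \<delta> \<rho>], of "\<bar>a m\<bar>"] that assms by (simp add: mult_ac)
  have big: "((\<lambda>m. (\<delta> / \<rho>) * (\<bar>a m\<bar> * monomial n (\<lambda>_. \<rho>) m)) has_sum (\<delta> / \<rho>) * L) ?M"
    by (intro has_sum_cmult_right a)
  have s: "(\<lambda>m. \<bar>a m\<bar> * monomial n (\<lambda>_. \<delta>) m) summable_on (?M - {?z})"
  proof (rule summable_on_comparison_test[OF _ le])
    show "(\<lambda>m. (\<delta> / \<rho>) * (\<bar>a m\<bar> * monomial n (\<lambda>_. \<rho>) m)) summable_on (?M - {?z})"
      by (rule summable_on_subset_banach[OF has_sum_imp_summable[OF big]]) auto
    show "0 \<le> \<bar>a m\<bar> * monomial n (\<lambda>_. \<delta>) m" for m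
      using monomial_pos[OF assms(2), of n m] by simp
  qed
  show ?thesis
  proof (rule power_series_leI[where J = "?M - {?z}" and e = "\<lambda>m. m" and c = a, OF assms(2)])
    show "((\<lambda>m. \<bar>a m\<bar> * monomial n (\<lambda>_. \<delta>) m) has_sum (\<Sum>\<^sub>\<infinity>m\<in>?M - {?z}. \<bar>a m\<bar> * monomial n (\<lambda>_. \<delta>) m)) (?M - {?z})"
      by (rule has_sum_infsum[OF s])
    have "(\<Sum>\<^sub>\<infinity>m\<in>?M - {?z}. \<bar>a m\<bar> * monomial n (\<lambda>_. \<delta>) m) \<le> (\<delta> / \<rho>) * L"
      unfolding infsumI[OF big, symmetric]
    proof (rule infsum_mono_neutral[OF s has_sum_imp_summable[OF big] le])
      show "0 \<le> (\<delta> / \<rho>) * (\<bar>a m\<bar> * monomial n (\<lambda>_. \<rho>) m)" for m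
        using \<rho> assms(2) monomial_nonneg[of \<rho> n m] by simp
    qed auto
    also have "\<dots> \<le> (\<delta> / \<rho>) * K" using a assms by (intro mult_left_mono) auto
    finally show "(\<Sum>\<^sub>\<infinity>m\<in>?M - {?z}. \<bar>a m\<bar> * monomial n (\<lambda>_. \<delta>) m) \<le> (\<delta> / \<rho>) * K" .
    fix y assume "y \<in> cube n p \<delta>"
    then have y: "y \<in> cube n p \<rho>" using cube_mono[OF assms(3)] by blast
    show "((\<lambda>m. a m * monomial n (\<lambda>i. y i - p i) m) has_sum f y - f p) (?M - {?z})"
      by (rule has_sum_Diff[OF a(3)[OF y]]) (use z in \<open>auto simp: fp intro!: has_sum_finiteI\<close>)
  qed auto
qed

lemma power_series_le_const: "\<rho> > 0 \<Longrightarrow> power_series_le n p \<rho> \<bar>c\<bar> (\<lambda>_. c)"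
  by (rule power_series_leI[where J = "{()}" and c = "\<lambda>_. c" and e = "\<lambda>_ _. 0" and L = "\<bar>c\<bar>"])
     (simp_all add: multi_indices_def has_sum_finite_iff)

lemma monomial_unit: "i < n \<Longrightarrow> monomial n d (\<lambda>k. if k = i then 1 else 0) = d i"
proof -
  assume i: "i < n"
  have "monomial n d (\<lambda>k. if k = i then 1 else 0) = (\<Prod>k<n. if k = i then d k else 1)"
    unfolding monomial_def by (intro prod.cong) auto
  then show ?thesis using i by (simp add: prod.delta)
qed

lemma power_series_le_coordinate:
  assumes "\<rho> > 0" "i < n"
  shows "power_series_le n p \<rho> (\<rho> + \<bar>p i\<bar>) (\<lambda>y. y i)"
  by (rule power_series_leI[where J = UNIV and c = "\<lambda>b. if b then 1 else p i"
        and e = "\<lambda>b. if b then (\<lambda>k. if k = i then 1 else 0) else (\<lambda>_. 0)" and L = "\<rho> + \<bar>p i\<bar>"])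
     (use assms in \<open>auto simp: multi_indices_def UNIV_bool has_sum_finite_iff monomial_unit\<close>)

lemma has_sum_times:
  fixes f :: "'i \<Rightarrow> real" and g :: "'j \<Rightarrow> real"
  assumes f: "(f has_sum F) A" and g: "(g has_sum G) B"
  shows "((\<lambda>(x, y). f x * g y) has_sum F * G) (A \<times> B)"
proof (rule has_sum_SigmaI)
  show "((\<lambda>y. case (x, y) of (x, y) \<Rightarrow> f x * g y) has_sum f x * G) B" for x
    using has_sum_cmult_right[OF g] by simp
  show "((\<lambda>x. f x * G) has_sum F * G) A" by (rule has_sum_cmult_left[OF f])
  have f': "(\<lambda>x. \<bar>f x\<bar>) summable_on A" and g': "(\<lambda>x. \<bar>g x\<bar>) summable_on B"
    using f g summable_on_iff_abs_summable_on_real by (auto simp: summable_on_def)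
  have "(\<lambda>z. norm (case z of (x, y) \<Rightarrow> f x * g y)) summable_on A \<times> B"
  proof (rule summable_on_SigmaI)
    show "((\<lambda>y. norm (case (x, y) of (x, y) \<Rightarrow> f x * g y)) has_sum \<bar>f x\<bar> * (\<Sum>\<^sub>\<infinity>y\<in>B. \<bar>g y\<bar>)) B" for x
      using has_sum_cmult_right[OF has_sum_infsum[OF g'], of "\<bar>f x\<bar>"] by (simp add: abs_mult)
    show "(\<lambda>x. \<bar>f x\<bar> * (\<Sum>\<^sub>\<infinity>y\<in>B. \<bar>g y\<bar>)) summable_on A"
      using f' by (rule summable_on_cmult_left)
  qed auto
  then show "(\<lambda>(x, y). f x * g y) summable_on A \<times> B" by (rule abs_summable_summable)
qed

text \<open>The Cauchy product, indexed by pairs of exponents.\<close>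

lemma power_series_le_mult:
  assumes \<rho>: "\<rho> > 0" and f: "power_series_le n p \<rho> K f" and g: "power_series_le n p \<rho> L g"
  shows "power_series_le n p \<rho> (K * L) (\<lambda>y. f y * g y)"
proof -
  let ?M = "multi_indices n"
  obtain a K' where a: "((\<lambda>m. \<bar>a m\<bar> * monomial n (\<lambda>_. \<rho>) m) has_sum K') ?M" "0 \<le> K'" "K' \<le> K"
    "\<And>y. y \<in> cube n p \<rho> \<Longrightarrow> ((\<lambda>m. a m * monomial n (\<lambda>i. y i - p i) m) has_sum f y) ?M"
    using power_series_leE[OF f \<rho>] by metis
  obtain b L' where b: "((\<lambda>m. \<bar>b m\<bar> * monomial n (\<lambda>_. \<rho>) m) has_sum L') ?M" "0 \<le> L'" "L' \<le> L"
    "\<And>y. y \<in> cube n p \<rho> \<Longrightarrow> ((\<lambda>m. b m * monomial n (\<lambda>i. y i - p i) m) has_sum g y) ?M"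
    using power_series_leE[OF g \<rho>] by metis
  show ?thesis
  proof (rule power_series_leI[where J = "?M \<times> ?M" and c = "\<lambda>(m, m'). a m * b m'"
        and e = "\<lambda>(m, m') i. m i + m' i" and L = "K' * L'", OF \<rho>])
    show "K' * L' \<le> K * L" using a b by (intro mult_mono) auto
    show "((\<lambda>j. \<bar>case j of (m, m') \<Rightarrow> a m * b m'\<bar> *
        monomial n (\<lambda>_. \<rho>) (case j of (m, m') \<Rightarrow> \<lambda>i. m i + m' i)) has_sum K' * L') (?M \<times> ?M)"
      using has_sum_times[OF a(1) b(1)]
      by (rule has_sum_cong[THEN iffD1, rotated]) (auto simp: monomial_add abs_mult)
    show "((\<lambda>j. (case j of (m, m') \<Rightarrow> a m * b m') *
        monomial n (\<lambda>i. y i - p i) (case j of (m, m') \<Rightarrow> \<lambda>i. m i + m' i)) has_sum f y * g y) (?M \<times> ?M)"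
      if "y \<in> cube n p \<rho>" for y
      using has_sum_times[OF a(4)[OF that] b(4)[OF that]]
      by (rule has_sum_cong[THEN iffD1, rotated]) (auto simp: monomial_add)
  qed (auto simp: multi_indices_def)
qed

lemma power_series_le_power:
  assumes "\<rho> > 0" "power_series_le n p \<rho> K f"
  shows "power_series_le n p \<rho> (K ^ k) (\<lambda>y. f y ^ k)"
proof (induction k)
  case 0
  then show ?case using power_series_le_const[OF assms(1), of n p 1] by simp
next
  case (Suc k)
  then show ?case using power_series_le_mult[OF assms] by simp
qed

lemma power_series_le_monomial:
  assumes "\<rho> > 0" "\<And>j. j < m \<Longrightarrow> power_series_le n p \<rho> K (f j)"
  shows "power_series_le n p \<rho> (monomial m (\<lambda>_. K) q) (\<lambda>y. monomial m (\<lambda>j. f j y) q)"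
  using assms(2) unfolding monomial_def
proof (induction m)
  case 0
  then show ?case using power_series_le_const[OF assms(1), of n p 1] by simp
next
  case (Suc m)
  then show ?case using power_series_le_mult[OF assms(1) _ power_series_le_power[OF assms(1)]] by simp
qed

text \<open>Completeness: a pointwise sum of functions whose norms are summable is again given by a power
  series; its terms are indexed by pairs of a summand and an exponent.\<close>

lemma power_series_le_has_sum:
  assumes \<rho>: "\<rho> > 0" and f: "\<And>q. q \<in> P \<Longrightarrow> power_series_le n p \<rho> (K q) (f q)"
    and K: "(K has_sum L) P"
    and F: "\<And>y. y \<in> cube n p \<rho> \<Longrightarrow> ((\<lambda>q. f q y) has_sum F y) P"
  shows "power_series_le n p \<rho> L F"
proof -
  let ?M = "multi_indices n"
  \<comment> \<open>Named so that coefficients and norms can be chosen for all summands at once.\<close>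
  define expands where "expands q a S \<longleftrightarrow>
      ((\<lambda>m. \<bar>a m\<bar> * monomial n (\<lambda>_. \<rho>) m) has_sum S) ?M \<and> 0 \<le> S \<and> S \<le> K q \<and>
      (\<forall>y\<in>cube n p \<rho>. ((\<lambda>m. a m * monomial n (\<lambda>i. y i - p i) m) has_sum f q y) ?M)" for q a S
  have "\<exists>a S. expands q a S" if "q \<in> P" for q
    unfolding expands_def by (rule power_series_leE[OF f[OF that] \<rho>]) blast
  then obtain a S where aS: "\<And>q. q \<in> P \<Longrightarrow> expands q (a q) (S q)" by metis
  have a: "\<And>q. q \<in> P \<Longrightarrow> ((\<lambda>m. \<bar>a q m\<bar> * monomial n (\<lambda>_. \<rho>) m) has_sum S q) ?M"
    and S: "\<And>q. q \<in> P \<Longrightarrow> 0 \<le> S q" "\<And>q. q \<in> P \<Longrightarrow> S q \<le> K q"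
    and fa: "\<And>q y. q \<in> P \<Longrightarrow> y \<in> cube n p \<rho> \<Longrightarrow> ((\<lambda>m. a q m * monomial n (\<lambda>i. y i - p i) m) has_sum f q y) ?M"
    using aS unfolding expands_def by blast+
  have S_sum: "S summable_on P"
    by (rule summable_on_comparison_test[where f = K]) (use K S in \<open>auto simp: summable_on_def\<close>)
  let ?h = "\<lambda>(q, m). \<bar>a q m\<bar> * monomial n (\<lambda>_. \<rho>) m"
  have nn: "monomial n (\<lambda>_. \<rho>) m \<ge> 0" for m using \<rho> by (simp add: monomial_nonneg)
  have h: "?h summable_on P \<times> ?M"
    by (rule summable_on_SigmaI[where g = S]) (use a S_sum nn in auto)
  have h_sum: "(?h has_sum infsum S P) (P \<times> ?M)"
    by (rule has_sum_SigmaI[where g = S]) (use a S_sum h in auto)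
  show ?thesis
  proof (rule power_series_leI[where J = "P \<times> ?M" and c = "\<lambda>(q, m). a q m" and e = snd and L = "infsum S P", OF \<rho>])
    show "((\<lambda>j. \<bar>case j of (q, m) \<Rightarrow> a q m\<bar> * monomial n (\<lambda>_. \<rho>) (snd j)) has_sum infsum S P) (P \<times> ?M)"
      using h_sum by (simp add: case_prod_unfold)
    show "infsum S P \<le> L"
      unfolding infsumI[OF K, symmetric]
      by (rule infsum_mono[OF S_sum]) (use S K in \<open>auto simp: summable_on_def\<close>)
    fix y assume y: "y \<in> cube n p \<rho>"
    let ?t = "\<lambda>j. (case j of (q, m) \<Rightarrow> a q m) * monomial n (\<lambda>i. y i - p i) (snd j)"
    show "(?t has_sum F y) (P \<times> ?M)"
    proof (rule has_sum_SigmaI[where g = "\<lambda>q. f q y"])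
      show "((\<lambda>m. ?t (q, m)) has_sum f q y) ?M" if "q \<in> P" for q using fa[OF that y] by simp
      have "(\<lambda>j. norm (?t j)) summable_on P \<times> ?M"
      proof (rule summable_on_comparison_test[OF h])
        show "norm (?t j) \<le> ?h j" for j
          using abs_monomial_le_cube[OF y, of "snd j"] by (simp add: case_prod_unfold abs_mult mult_left_mono)
      qed auto
      then show "?t summable_on P \<times> ?M" by (rule abs_summable_summable)
    qed (rule F[OF y])
  qed auto
qed

section \<open>Analytic functions\<close>

text \<open>Evaluating the given expansion at a corner of a small cube yields absolute convergence on the
  whole cube.\<close>

lemma analytic_power_series:
  assumes "analytic_fun_on n S g" and S: "openin (Euclidean_space n) S" and x: "x \<in> S"
  shows "\<exists>\<rho> K. \<rho> > 0 \<and> cube n x \<rho> \<subseteq> S \<and> power_series_le n x \<rho> K g"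
proof -
  obtain e a where e: "e > 0" and a: "\<And>y. y \<in> S \<Longrightarrow> (\<forall>i<n. \<bar>y i - x i\<bar> < e) \<Longrightarrow>
      ((\<lambda>m. a m * monomial n (\<lambda>i. y i - x i) m) has_sum g y) (multi_indices n)"
    using bspec[OF assms(1)[unfolded analytic_fun_on_def] x]
    unfolding monomial_def multi_indices_def by blast
  obtain d where d: "d > 0" "cube n x d \<subseteq> S" using cube_subset_open[OF S x] by blast
  define \<rho> where "\<rho> = min d (e / 2)"
  have \<rho>: "\<rho> > 0" "\<rho> \<le> d" "\<rho> < e" using d e by (auto simp: \<rho>_def)
  have sub: "cube n x \<rho> \<subseteq> S" using d cube_mono[OF \<rho>(2)] by blast
  have ser: "((\<lambda>m. a m * monomial n (\<lambda>i. y i - x i) m) has_sum g y) (multi_indices n)"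
    if "y \<in> cube n x \<rho>" for y
    using that sub \<rho> by (intro a) (auto simp: cube_def)
  \<comment> \<open>A corner of the cube, where every monomial takes its weight as value.\<close>
  let ?y = "\<lambda>i. if i < n then x i + \<rho> else 0"
  have "?y \<in> cube n x \<rho>" using \<rho> by (simp add: cube_def topspace_Euclidean_space)
  from ser[OF this] have "(\<lambda>m. a m * monomial n (\<lambda>i. ?y i - x i) m) summable_on multi_indices n"
    by (auto simp: summable_on_def)
  moreover have "monomial n (\<lambda>i. ?y i - x i) m = monomial n (\<lambda>_. \<rho>) m" for m
    unfolding monomial_def by (intro prod.cong) auto
  ultimately have "(\<lambda>m. \<bar>a m * monomial n (\<lambda>_. \<rho>) m\<bar>) summable_on multi_indices n"
    using iffD1[OF summable_on_iff_abs_summable_on_real, of "\<lambda>m. a m * monomial n (\<lambda>_. \<rho>) m"] by simp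
  then have "(\<lambda>m. \<bar>a m\<bar> * monomial n (\<lambda>_. \<rho>) m) summable_on multi_indices n"
    using monomial_pos[OF \<rho>(1)] by (simp add: abs_mult less_imp_le)
  then have "power_series_le n x \<rho> (\<Sum>\<^sub>\<infinity>m\<in>multi_indices n. \<bar>a m\<bar> * monomial n (\<lambda>_. \<rho>) m) g"
    unfolding power_series_le_def using ser by blast
  then show ?thesis using \<rho> sub by blast
qed

lemma power_series_analytic:
  assumes "S \<subseteq> topspace (Euclidean_space n)"
    and "\<And>x. x \<in> S \<Longrightarrow> \<exists>\<rho> K. \<rho> > 0 \<and> power_series_le n x \<rho> K g"
  shows "analytic_fun_on n S g"
  unfolding analytic_fun_on_def
proof (intro ballI)
  fix x assume "x \<in> S"
  then obtain \<rho> a where "\<rho> > 0" and a: "\<And>y. y \<in> cube n x \<rho> \<Longrightarrow>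
      ((\<lambda>m. a m * monomial n (\<lambda>i. y i - x i) m) has_sum g y) (multi_indices n)"
    using assms(2) unfolding power_series_le_def by metis
  moreover have "y \<in> cube n x \<rho>" if "y \<in> S" "\<forall>i<n. \<bar>y i - x i\<bar> < \<rho>" for y
    using that assms(1) by (auto simp: cube_def less_imp_le)
  ultimately show "\<exists>e>0. \<exists>a. \<forall>y\<in>S. (\<forall>i<n. \<bar>y i - x i\<bar> < e) \<longrightarrow>
      ((\<lambda>m. a m * (\<Prod>i<n. (y i - x i) ^ m i)) has_sum g y) {m. \<forall>i\<ge>n. m i = 0}"
    unfolding monomial_def multi_indices_def by blast
qed

lemma power_series_oscillation:
  assumes "power_series_le n x \<rho> K g" "\<rho> > 0" "\<epsilon> > 0" "x \<in> topspace (Euclidean_space n)"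
  shows "\<exists>\<delta>>0. \<delta> \<le> \<rho> \<and> power_series_le n x \<delta> \<epsilon> (\<lambda>y. g y - g x)"
proof -
  obtain L where "0 \<le> L" "L \<le> K" using power_series_leE[OF assms(1,2)] by metis
  then have K: "K \<ge> 0" by simp
  \<comment> \<open>Chosen so that \<open>(\<delta> / \<rho>) * K \<le> \<epsilon>\<close>; adding \<open>1\<close> to \<open>K\<close> covers the case \<open>K = 0\<close>.\<close>
  define \<delta> where "\<delta> = min \<rho> (\<rho> * \<epsilon> / (K + 1))"
  have \<delta>: "\<delta> > 0" "\<delta> \<le> \<rho>" using assms K by (auto simp: \<delta>_def)
  have "\<delta> / \<rho> \<le> (\<rho> * \<epsilon> / (K + 1)) / \<rho>"
    unfolding \<delta>_def using assms by (intro divide_right_mono) auto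
  also have "\<dots> = \<epsilon> / (K + 1)" using assms by simp
  finally have "(\<delta> / \<rho>) * K \<le> \<epsilon> / (K + 1) * K" using K by (intro mult_right_mono) auto
  also have "\<dots> \<le> \<epsilon>" using K assms by (simp add: field_simps)
  finally have "(\<delta> / \<rho>) * K \<le> \<epsilon>" .
  with power_series_le_center[OF assms(1) \<delta> assms(4)] have "power_series_le n x \<delta> \<epsilon> (\<lambda>y. g y - g x)"
    unfolding power_series_le_def by force
  then show ?thesis using \<delta> by blast
qed

lemma analytic_continuous:
  assumes "analytic_fun_on n S g" and S: "openin (Euclidean_space n) S"
  shows "continuous_map (subtopology (Euclidean_space n) S) euclideanreal g"
  unfolding continuous_map_cubes[OF S]
proof (intro ballI allI impI)
  fix x and \<epsilon> :: real assume x: "x \<in> S" and \<epsilon>: "\<epsilon> > 0"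
  obtain \<rho> K where \<rho>: "\<rho> > 0" "cube n x \<rho> \<subseteq> S" "power_series_le n x \<rho> K g"
    using analytic_power_series[OF assms x] by blast
  have "x \<in> topspace (Euclidean_space n)" using x openin_subset[OF S] by blast
  from power_series_oscillation[OF \<rho>(3,1) _ this, of "\<epsilon> / 2"] \<epsilon> 
  obtain \<delta> where \<delta>: "\<delta> > 0" "\<delta> \<le> \<rho>" "power_series_le n x \<delta> (\<epsilon> / 2) (\<lambda>y. g y - g x)" by auto
  have "\<bar>g y - g x\<bar> < \<epsilon>" if "y \<in> cube n x \<delta>" for y
    using power_series_le_abs_le[OF \<delta>(3,1) that] \<epsilon> by simp
  then show "\<exists>d>0. cube n x d \<subseteq> S \<and> (\<forall>y\<in>cube n x d. \<bar>g y - g x\<bar> < \<epsilon>)"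
    using \<delta> \<rho> cube_mono[OF \<delta>(2)] by blast
qed

text \<open>Expand \<open>g\<close> about \<open>F x\<close> and substitute the increments \<open>F y j - F x j\<close>. On a small cube these have
  norm at most the radius \<open>\<eta>\<close> of the expansion of \<open>g\<close>, so that the norms of the substituted
  terms are dominated by the weighted coefficients of \<open>g\<close>, which are summable.\<close>

lemma analytic_compose:
  assumes P: "openin (Euclidean_space m) P" and S: "openin (Euclidean_space n) S"
    and FP: "\<And>x. x \<in> S \<Longrightarrow> F x \<in> P"
    and g: "analytic_fun_on m P g" and F: "\<And>j. j < m \<Longrightarrow> analytic_fun_on n S (\<lambda>x. F x j)"
  shows "analytic_fun_on n S (\<lambda>x. g (F x))"
proof (rule power_series_analytic[OF openin_subset[OF S]])
  fix x assume x: "x \<in> S"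
  then have xE: "x \<in> topspace (Euclidean_space n)" using openin_subset[OF S] by blast
  obtain \<eta> K where \<eta>: "\<eta> > 0" "cube m (F x) \<eta> \<subseteq> P" "power_series_le m (F x) \<eta> K g"
    using analytic_power_series[OF g P FP[OF x]] by blast
  obtain b L where b: "((\<lambda>q. \<bar>b q\<bar> * monomial m (\<lambda>_. \<eta>) q) has_sum L) (multi_indices m)"
    "\<And>z. z \<in> cube m (F x) \<eta> \<Longrightarrow> ((\<lambda>q. b q * monomial m (\<lambda>j. z j - F x j) q) has_sum g z) (multi_indices m)"
    using power_series_leE[OF \<eta>(3,1)] by metis
  have "\<exists>\<delta>>0. power_series_le n x \<delta> \<eta> (\<lambda>y. F y j - F x j)" if "j < m" for j
    using analytic_power_series[OF F[OF that] S x] power_series_oscillation[OF _ _ \<eta>(1) xE] by blast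
  then obtain \<delta>1 where \<delta>1: "\<delta>1 > 0" "\<And>j. j < m \<Longrightarrow> power_series_le n x \<delta>1 \<eta> (\<lambda>y. F y j - F x j)"
    using ex_common_radius[of m "\<lambda>j \<delta>. power_series_le n x \<delta> \<eta> (\<lambda>y. F y j - F x j)"] power_series_le_mono
    by blast
  obtain \<delta>2 where \<delta>2: "\<delta>2 > 0" "cube n x \<delta>2 \<subseteq> S" using cube_subset_open[OF S x] by blast
  define \<delta> where "\<delta> = min \<delta>1 \<delta>2"
  have \<delta>: "\<delta> > 0" "\<delta> \<le> \<delta>1" "\<delta> \<le> \<delta>2" using \<delta>1 \<delta>2 by (auto simp: \<delta>_def)
  have Fj: "power_series_le n x \<delta> \<eta> (\<lambda>y. F y j - F x j)" if "j < m" for j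
    using power_series_le_mono[OF \<delta>1(2)[OF that] \<delta>(1,2)] .
  have "power_series_le n x \<delta> L (\<lambda>y. g (F y))"
  proof (rule power_series_le_has_sum[OF \<delta>(1) _ b(1)])
    show "power_series_le n x \<delta> (\<bar>b q\<bar> * monomial m (\<lambda>_. \<eta>) q) (\<lambda>y. b q * monomial m (\<lambda>j. F y j - F x j) q)" for q
      using \<delta> Fj by (intro power_series_le_mult power_series_le_const power_series_le_monomial) auto
    fix y assume y: "y \<in> cube n x \<delta>"
    then have "y \<in> S" using \<delta>2 cube_mono[OF \<delta>(3)] by blast
    then have "F y \<in> topspace (Euclidean_space m)" using FP openin_subset[OF P] by blast
    then have "F y \<in> cube m (F x) \<eta>"
      using power_series_le_abs_le[OF Fj \<delta>(1) y] by (simp add: cube_def)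
    then show "((\<lambda>q. b q * monomial m (\<lambda>j. F y j - F x j) q) has_sum g (F y)) (multi_indices m)" by (rule b)
  qed
  then show "\<exists>\<rho> K. \<rho> > 0 \<and> power_series_le n x \<rho> K (\<lambda>x. g (F x))" using \<delta> by blast
qed

section \<open>Maps of class \<open>C\<^sup>r\<close>\<close>

text \<open>All classes except \<open>\<omega>\<close> amount to being \<open>C\<^sup>k\<close> for every \<open>k\<close> in some set of orders, which reduces
  statements about \<open>C\<^sup>r\<close> functions to two cases.\<close>

definition Ck_orders :: "diffclass \<Rightarrow> nat set" where
  "Ck_orders r = (case r of C_top \<Rightarrow> {0} | C_fin k \<Rightarrow> {k} | C_inf \<Rightarrow> UNIV | C_an \<Rightarrow> {})"

lemma Cr_on_iff:
  "Cr_on r n S g \<longleftrightarrow> (if r = C_an then analytic_fun_on n S g else \<forall>k\<in>Ck_orders r. Ck_on k n S g)"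
  unfolding Cr_on_def Ck_orders_def by (cases r) (simp_all del: Ck_on.simps)

lemma Ck_orders_nonempty: "r \<noteq> C_an \<Longrightarrow> \<exists>k. k \<in> Ck_orders r"
  by (cases r) (auto simp: Ck_orders_def)

lemma analytic_subset: "analytic_fun_on n S g \<Longrightarrow> S' \<subseteq> S \<Longrightarrow> analytic_fun_on n S' g"
  unfolding analytic_fun_on_def by (meson subsetD)

lemma Cr_on_subset:
  assumes "Cr_on r n S g" "S' \<subseteq> S"
  shows "Cr_on r n S' g"
  using assms(1) Ck_on_subset[OF _ assms(2)] analytic_subset[OF _ assms(2)]
  by (auto simp: Cr_on_iff split: if_splits)

lemma Cr_on_continuous:
  assumes g: "Cr_on r n S g" and S: "openin (Euclidean_space n) S"
  shows "continuous_map (subtopology (Euclidean_space n) S) euclideanreal g"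
proof (cases "r = C_an")
  case True
  then show ?thesis using g analytic_continuous[OF _ S] by (simp add: Cr_on_iff)
next
  case False
  then obtain k where "k \<in> Ck_orders r" using Ck_orders_nonempty by blast
  then have "Ck_on k n S g" using g False by (simp add: Cr_on_iff)
  then show ?thesis by (rule Ck_on_continuous)
qed

lemma Cr_on_compose:
  assumes P: "openin (Euclidean_space m) P" and S: "openin (Euclidean_space n) S"
    and FP: "\<And>x. x \<in> S \<Longrightarrow> F x \<in> P"
    and g: "Cr_on r m P g" and F: "\<And>j. j < m \<Longrightarrow> Cr_on r n S (\<lambda>x. F x j)"
  shows "Cr_on r n S (\<lambda>x. g (F x))"
proof (cases "r = C_an")
  case True
  have "analytic_fun_on n S (\<lambda>x. g (F x))"
    by (rule analytic_compose[OF P S FP]) (use g F True in \<open>simp_all add: Cr_on_iff\<close>)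
  then show ?thesis using True by (simp add: Cr_on_iff)
next
  case False
  have "Ck_on k n S (\<lambda>x. g (F x))" if "k \<in> Ck_orders r" for k
    by (rule Ck_on_compose[OF P S FP]) (use g F False that in \<open>simp_all add: Cr_on_iff\<close>)
  then show ?thesis using False by (simp add: Cr_on_iff)
qed

lemma Cr_on_const:
  assumes "S \<subseteq> topspace (Euclidean_space n)"
  shows "Cr_on r n S (\<lambda>x. c)"
proof -
  have "analytic_fun_on n S (\<lambda>x. c)"
    using power_series_le_const[OF zero_less_one] zero_less_one
    by (intro power_series_analytic[OF assms]) blast
  then show ?thesis by (simp add: Cr_on_iff Ck_on_const)
qed

lemma Cr_on_coordinate:
  assumes "S \<subseteq> topspace (Euclidean_space n)" "i < n"
  shows "Cr_on r n S (\<lambda>x. x i)"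
proof -
  have "analytic_fun_on n S (\<lambda>x. x i)"
    using power_series_le_coordinate[OF zero_less_one assms(2)] zero_less_one
    by (intro power_series_analytic[OF assms(1)]) blast
  then show ?thesis by (simp add: Cr_on_iff Ck_on_coordinate)
qed

text \<open>One of the local extensions whose existence near every point makes a map \<open>C\<^sup>r\<close>.\<close>

definition Cr_extension ::
    "diffclass \<Rightarrow> nat \<Rightarrow> nat \<Rightarrow> (nat \<Rightarrow> real) set \<Rightarrow> ((nat \<Rightarrow> real) \<Rightarrow> nat \<Rightarrow> real) \<Rightarrow>
      (nat \<Rightarrow> real) set \<Rightarrow> ((nat \<Rightarrow> real) \<Rightarrow> nat \<Rightarrow> real) \<Rightarrow> bool" where
  "Cr_extension r n m S f A F \<longleftrightarrow> openin (Euclidean_space n) A \<and>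
     (\<forall>i<m. Cr_on r n A (\<lambda>x. F x i)) \<and> (\<forall>x\<in>A \<inter> S. \<forall>i<m. F x i = f x i)"

lemma Cr_map_iff: "Cr_map r n m S f \<longleftrightarrow> (\<forall>p\<in>S. \<exists>A F. p \<in> A \<and> Cr_extension r n m S f A F)"
  unfolding Cr_map_def Cr_extension_def by (intro ball_cong ex_cong1 refl) auto

lemma Cr_extensionI:
  assumes "openin (Euclidean_space n) A" "\<And>i. i < m \<Longrightarrow> Cr_on r n A (\<lambda>x. F x i)"
    "\<And>x i. x \<in> A \<Longrightarrow> x \<in> S \<Longrightarrow> i < m \<Longrightarrow> F x i = f x i"
  shows "Cr_extension r n m S f A F"
  using assms unfolding Cr_extension_def by simp

lemma Cr_extensionD:
  assumes "Cr_extension r n m S f A F"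
  shows "openin (Euclidean_space n) A" "\<And>i. i < m \<Longrightarrow> Cr_on r n A (\<lambda>x. F x i)"
    "\<And>x i. x \<in> A \<Longrightarrow> x \<in> S \<Longrightarrow> i < m \<Longrightarrow> F x i = f x i"
  using assms unfolding Cr_extension_def by simp_all

lemma Cr_map_mono:
  assumes f: "Cr_map r n m S f" and "S' \<subseteq> S" "k \<le> m" "\<And>x i. x \<in> S' \<Longrightarrow> i < k \<Longrightarrow> f x i = g x i"
  shows "Cr_map r n k S' g"
  unfolding Cr_map_iff
proof
  fix p assume "p \<in> S'"
  then obtain A F where p: "p \<in> A" and F: "Cr_extension r n m S f A F"
    using f assms(2) unfolding Cr_map_iff by blast
  have "Cr_extension r n k S' g A F"
    by (rule Cr_extensionI) (use Cr_extensionD[OF F] assms(2-4) in \<open>auto simp: subset_iff\<close>)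
  then show "\<exists>A F. p \<in> A \<and> Cr_extension r n k S' g A F" using p by blast
qed

lemma Cr_map_cong:
  assumes "Cr_map r n m S f" "\<And>x i. x \<in> S \<Longrightarrow> i < m \<Longrightarrow> f x i = g x i"
  shows "Cr_map r n m S g"
  using assms(2) by (intro Cr_map_mono[OF assms(1)]) simp_all

lemma Cr_map_subset: "Cr_map r n m S f \<Longrightarrow> S' \<subseteq> S \<Longrightarrow> Cr_map r n m S' f"
  by (erule Cr_map_mono) simp_all

lemma Cr_map_local:
  assumes "\<And>p. p \<in> S \<Longrightarrow> \<exists>N. openin (Euclidean_space n) N \<and> p \<in> N \<and> Cr_map r n m (S \<inter> N) f"
  shows "Cr_map r n m S f"
  unfolding Cr_map_iff
proof
  fix p assume p: "p \<in> S"
  then obtain N where N: "openin (Euclidean_space n) N" "p \<in> N" "Cr_map r n m (S \<inter> N) f" using assms by blast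
  then obtain A F where A: "p \<in> A" and F: "Cr_extension r n m (S \<inter> N) f A F"
    using p unfolding Cr_map_iff by blast
  have "Cr_extension r n m S f (A \<inter> N) F"
    by (rule Cr_extensionI)
       (use Cr_extensionD[OF F] N(1) Cr_on_subset[OF _ Int_lower1] in \<open>auto intro: openin_Int\<close>)
  then show "\<exists>A F. p \<in> A \<and> Cr_extension r n m S f A F" using A N by blast
qed

text \<open>Local extensions \<open>F\<close> of \<open>f\<close> and \<open>G\<close> of \<open>g\<close> compose once the values of \<open>F\<close> are cut down to \<open>\<real>\<^sup>m\<close>, since only
  their first \<open>m\<close> coordinates are controlled. On \<open>S\<close> this changes nothing, because \<open>f\<close> takes values in
  \<open>\<real>\<^sup>m\<close> there.\<close>

lemma Cr_map_compose:
  assumes f: "Cr_map r n m S f" and g: "Cr_map r m l T g"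
    and fT: "\<And>x. x \<in> S \<Longrightarrow> f x \<in> T" and T: "T \<subseteq> topspace (Euclidean_space m)"
  shows "Cr_map r n l S (\<lambda>x. g (f x))"
  unfolding Cr_map_iff
proof
  fix p assume p: "p \<in> S"
  then obtain A F where pA: "p \<in> A" and F: "Cr_extension r n m S f A F"
    using f unfolding Cr_map_iff by blast
  obtain B G where pB: "f p \<in> B" and G: "Cr_extension r m l T g B G"
    using g fT[OF p] unfolding Cr_map_iff by blast
  note A = Cr_extensionD[OF F] and B = Cr_extensionD[OF G]
  define F' where "F' x = (\<lambda>i. if i < m then F x i else 0)" for x
  have F'f: "F' x = f x" if "x \<in> A" "x \<in> S" for x
  proof
    fix i
    have "f x \<in> topspace (Euclidean_space m)" using T fT[OF that(2)] by blast
    then show "F' x i = f x i" using A(3)[OF that] by (simp add: F'_def topspace_Euclidean_space)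
  qed
  let ?D = "{x \<in> A. F' x \<in> B}"
  have "continuous_map (subtopology (Euclidean_space n) A) (Euclidean_space m) F'"
    unfolding F'_def continuous_map_componentwise_Euclidean_space
    using Cr_on_continuous[OF A(2) A(1)] by simp
  then have "openin (subtopology (Euclidean_space n) A) {x \<in> topspace (subtopology (Euclidean_space n) A). F' x \<in> B}"
    by (rule openin_continuous_map_preimage) (rule B)
  moreover have "{x \<in> topspace (subtopology (Euclidean_space n) A). F' x \<in> B} = ?D"
    using openin_subset[OF A(1)] by auto
  ultimately have open': "openin (Euclidean_space n) ?D"
    using openin_open_subtopology[OF A(1)] by simp
  have "Cr_extension r n l S (\<lambda>x. g (f x)) ?D (\<lambda>x. G (F' x))"
  proof (rule Cr_extensionI[OF open'])
    fix i assume i: "i < l"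
    show "Cr_on r n ?D (\<lambda>x. G (F' x) i)"
    proof (rule Cr_on_compose[OF B(1) open' _ B(2)[OF i]])
      fix j assume j: "j < m"
      then show "Cr_on r n ?D (\<lambda>x. F' x j)"
        using Cr_on_subset[OF A(2)[OF j], of ?D] by (simp add: F'_def)
    qed simp
    show "G (F' x) i = g (f x) i" if x: "x \<in> ?D" "x \<in> S" for x
    proof -
      have "F' x = f x" using F'f x by simp
      then show ?thesis using B(3)[of "f x" i] x fT[OF x(2)] i by simp
    qed
  qed
  moreover have "p \<in> ?D" using pA pB F'f[OF pA p] by simp
  ultimately show "\<exists>A F. p \<in> A \<and> Cr_extension r n l S (\<lambda>x. g (f x)) A F"
    by (intro exI[of _ ?D] exI[of _ "\<lambda>x. G (F' x)"] conjI)
qed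

lemma Cr_map_pair:
  assumes f: "Cr_map r n a S f" and g: "Cr_map r n b S g"
  shows "Cr_map r n (a + b) S (\<lambda>x i. if i < a then f x i else g x (i - a))"
  unfolding Cr_map_iff
proof
  fix p assume p: "p \<in> S"
  obtain A F where pA: "p \<in> A" and F: "Cr_extension r n a S f A F"
    using f p unfolding Cr_map_iff by blast
  obtain B G where pB: "p \<in> B" and G: "Cr_extension r n b S g B G"
    using g p unfolding Cr_map_iff by blast
  note A = Cr_extensionD[OF F] and B = Cr_extensionD[OF G]
  let ?H = "\<lambda>x i. if i < a then F x i else G x (i - a)"
  have "Cr_extension r n (a + b) S (\<lambda>x i. if i < a then f x i else g x (i - a)) (A \<inter> B) ?H"
  proof (rule Cr_extensionI)
    show "openin (Euclidean_space n) (A \<inter> B)" using A B by (intro openin_Int)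
    fix i assume i: "i < a + b"
    show "Cr_on r n (A \<inter> B) (\<lambda>x. ?H x i)"
    proof (cases "i < a")
      case True
      then show ?thesis using Cr_on_subset[OF A(2) Int_lower1] by simp
    next
      case False
      then have "i - a < b" using i by simp
      then show ?thesis using Cr_on_subset[OF B(2) Int_lower2] False by simp
    qed
    show "?H x i = (if i < a then f x i else g x (i - a))" if "x \<in> A \<inter> B" "x \<in> S" for x
      using that A(3)[of x i] B(3)[of x "i - a"] i by simp
  qed
  then show "\<exists>A F. p \<in> A \<and> Cr_extension r n (a + b) S (\<lambda>x i. if i < a then f x i else g x (i - a)) A F"
    using pA pB by blast
qed

lemma Cr_map_coordinates:
  assumes S: "S \<subseteq> topspace (Euclidean_space n)"
    and f: "\<And>i. i < m \<Longrightarrow> (\<exists>j<n. \<forall>x\<in>S. f x i = x j) \<or> (\<forall>x\<in>S. f x i = 0)"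
  shows "Cr_map r n m S f"
  unfolding Cr_map_iff
proof
  fix p assume p: "p \<in> S"
  let ?E = "topspace (Euclidean_space n)"
  have "\<exists>h. Cr_on r n ?E h \<and> (\<forall>x\<in>S. h x = f x i)" if "i < m" for i
    using f[OF that]
  proof
    assume "\<exists>j<n. \<forall>x\<in>S. f x i = x j"
    then obtain j where "j < n" "\<forall>x\<in>S. f x i = x j" by blast
    then show ?thesis by (intro exI[of _ "\<lambda>x. x j"]) (simp add: Cr_on_coordinate)
  next
    assume "\<forall>x\<in>S. f x i = 0"
    then show ?thesis by (intro exI[of _ "\<lambda>x. 0"]) (simp add: Cr_on_const)
  qed
  then obtain h where "\<And>i. i < m \<Longrightarrow> Cr_on r n ?E (h i) \<and> (\<forall>x\<in>S. h i x = f x i)" by metis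
  then have "Cr_extension r n m S f ?E (\<lambda>x i. h i x)"
    by (intro Cr_extensionI) simp_all
  then show "\<exists>A F. p \<in> A \<and> Cr_extension r n m S f A F" using p S by blast
qed

section \<open>Composition of smooth maps\<close>

text \<open>What composition in charts requires of the atlas of the intermediate and of the source space:
  charts are injective open maps into \<open>\<real>\<^sup>n\<close> and cover. Compatibility is left out, so
  that this can be verified for an atlas before it is known to define a manifold.\<close>

definition charted :: "diffclass \<Rightarrow> 'a mfd \<Rightarrow> bool" where
  "charted r M \<longleftrightarrow> r = C_top \<or>
    ((\<forall>(U, n, \<phi>)\<in>atlas M. openin (mtop M) U \<and> inj_on \<phi> U \<and>
        (\<forall>T. openin (mtop M) T \<longrightarrow> openin (Euclidean_space n) (\<phi> ` (U \<inter> T)))) \<and>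
     topspace (mtop M) \<subseteq> \<Union>(fst ` atlas M))"

text \<open>The chart condition of smoothness without the exception for \<open>r = 0\<close>: for the identity map it
  expresses the compatibility of two atlases, which is also required of manifolds of class \<open>C\<^sup>0\<close>.\<close>

definition Cr_in_charts :: "diffclass \<Rightarrow> 'a mfd \<Rightarrow> 'a set \<Rightarrow> 'b mfd \<Rightarrow> ('a \<Rightarrow> 'b) \<Rightarrow> bool" where
  "Cr_in_charts r M A N f \<longleftrightarrow>
    (\<forall>(U, n, \<phi>)\<in>atlas M. \<forall>(V, m, \<psi>)\<in>atlas N.
         Cr_map r n m (\<phi> ` {x \<in> A \<inter> U. f x \<in> V}) (\<psi> \<circ> f \<circ> inv_into U \<phi>))"

lemma smooth_on_iff:
  "smooth_on r M A N f \<longleftrightarrow> A \<subseteq> topspace (mtop M) \<and>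
    continuous_map (subtopology (mtop M) A) (mtop N) f \<and>
    (r \<noteq> C_top \<and> r \<noteq> C_fin 0 \<longrightarrow> Cr_in_charts r M A N f)"
  unfolding smooth_on_def Cr_in_charts_def by (rule refl)

lemma Cr_in_chartsD:
  assumes f: "Cr_in_charts r M A N f" and U: "(U, n, \<phi>) \<in> atlas M" and V: "(V, m, \<psi>) \<in> atlas N"
  shows "Cr_map r n m (\<phi> ` {x \<in> A \<inter> U. f x \<in> V}) (\<psi> \<circ> f \<circ> inv_into U \<phi>)"
  using bspec[OF f[unfolded Cr_in_charts_def] U] V by (simp only: prod.case) (drule (1) bspec, simp)

lemma charted_chartD:
  assumes "charted r M" "r \<noteq> C_top" "(U, n, \<phi>) \<in> atlas M"
  shows "openin (mtop M) U" "inj_on \<phi> U" "\<And>T. openin (mtop M) T \<Longrightarrow> openin (Euclidean_space n) (\<phi> ` (U \<inter> T))"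
    "\<phi> ` U \<subseteq> topspace (Euclidean_space n)"
proof -
  show *: "openin (mtop M) U" "inj_on \<phi> U" "\<And>T. openin (mtop M) T \<Longrightarrow> openin (Euclidean_space n) (\<phi> ` (U \<inter> T))"
    using assms unfolding charted_def by fast+
  show "\<phi> ` U \<subseteq> topspace (Euclidean_space n)"
    using *(3)[OF *(1)] openin_subset by fastforce
qed

lemma charted_cover:
  assumes "charted r M" "r \<noteq> C_top" "x \<in> topspace (mtop M)"
  obtains U n \<phi> where "(U, n, \<phi>) \<in> atlas M" "x \<in> U"
proof -
  obtain c where "c \<in> atlas M" "x \<in> fst c" using assms unfolding charted_def by blast
  then show thesis using that[of "fst c" "fst (snd c)" "snd (snd c)"] by simp
qed

text \<open>The problem is local, and near a given point the composite can be factored through one chart of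
  the intermediate space; the points that \<open>f\<close> sends into this chart form a relatively open set by
  continuity.\<close>

lemma Cr_in_charts_compose:
  assumes r: "r \<noteq> C_top" and M: "charted r M" and N: "charted r N" and A: "A \<subseteq> topspace (mtop M)"
    and cont: "continuous_map (subtopology (mtop M) A) (mtop N) f"
    and f: "Cr_in_charts r M A N f" and g: "Cr_in_charts r N B P g" and fB: "f ` A \<subseteq> B"
  shows "Cr_in_charts r M A P (\<lambda>x. g (f x))"
  unfolding Cr_in_charts_def
proof clarify
  fix U n \<phi> V m \<psi> assume U: "(U, n, \<phi>) \<in> atlas M" and V: "(V, m, \<psi>) \<in> atlas P"
  note U' = charted_chartD[OF M r U]
  let ?S = "\<phi> ` {x \<in> A \<inter> U. g (f x) \<in> V}"
  show "Cr_map r n m ?S (\<psi> \<circ> (\<lambda>x. g (f x)) \<circ> inv_into U \<phi>)"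
  proof (rule Cr_map_local)
    fix p assume "p \<in> ?S"
    then obtain x where x: "p = \<phi> x" "x \<in> A" "x \<in> U" "g (f x) \<in> V" by blast
    have "f x \<in> topspace (mtop N)" using cont x A by (auto simp: continuous_map_def)
    then obtain C b \<omega> where C: "(C, b, \<omega>) \<in> atlas N" "f x \<in> C" using charted_cover[OF N r] by metis
    note C' = charted_chartD[OF N r C(1)]
    have "openin (subtopology (mtop M) A) {y \<in> topspace (subtopology (mtop M) A). f y \<in> C}"
      by (rule openin_continuous_map_preimage[OF cont C'(1)])
    moreover have "{y \<in> topspace (subtopology (mtop M) A). f y \<in> C} = {y \<in> A. f y \<in> C}" using A by auto
    ultimately obtain T where T: "openin (mtop M) T" "{y \<in> A. f y \<in> C} = T \<inter> A"
      by (auto simp: openin_subtopology)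
    let ?R = "\<phi> ` {y \<in> A \<inter> U. f y \<in> C \<and> g (f y) \<in> V}"
    let ?T = "\<omega> ` {z \<in> B \<inter> C. g z \<in> V}"
    have inv: "inv_into U \<phi> (\<phi> y) = y" if "y \<in> U" for y using U'(2) that by simp
    have inv': "inv_into C \<omega> (\<omega> z) = z" if "z \<in> C" for z using C'(2) that by simp
    have "Cr_map r n b ?R (\<omega> \<circ> f \<circ> inv_into U \<phi>)"
      by (rule Cr_map_subset[OF Cr_in_chartsD[OF f U C(1)]]) auto
    then have "Cr_map r n m ?R (\<lambda>z. (\<psi> \<circ> g \<circ> inv_into C \<omega>) ((\<omega> \<circ> f \<circ> inv_into U \<phi>) z))"
    proof (rule Cr_map_compose[OF _ Cr_in_chartsD[OF g C(1) V]])
      show "(\<omega> \<circ> f \<circ> inv_into U \<phi>) z \<in> ?T" if "z \<in> ?R" for z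
        using that fB inv by auto
      show "?T \<subseteq> topspace (Euclidean_space b)" using C'(4) by blast
    qed
    then have "Cr_map r n m ?R (\<psi> \<circ> (\<lambda>x. g (f x)) \<circ> inv_into U \<phi>)"
      by (rule Cr_map_cong) (auto simp: inv inv')
    moreover have "?S \<inter> \<phi> ` (U \<inter> T) \<subseteq> ?R"
      using U'(2) T(2) unfolding inj_on_def by blast
    ultimately have "Cr_map r n m (?S \<inter> \<phi> ` (U \<inter> T)) (\<psi> \<circ> (\<lambda>x. g (f x)) \<circ> inv_into U \<phi>)"
      by (rule Cr_map_subset)
    moreover have "x \<in> T" using x C T by blast
    ultimately show "\<exists>N. openin (Euclidean_space n) N \<and> p \<in> N \<and>
        Cr_map r n m (?S \<inter> N) (\<psi> \<circ> (\<lambda>x. g (f x)) \<circ> inv_into U \<phi>)"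
      using U'(3)[OF T(1)] x by (intro exI[of _ "\<phi> ` (U \<inter> T)"]) auto
  qed
qed

lemma smooth_on_compose:
  assumes M: "charted r M" and N: "charted r N"
    and f: "smooth_on r M A N f" and g: "smooth_on r N B P g" and fB: "f ` A \<subseteq> B"
  shows "smooth_on r M A P (\<lambda>x. g (f x))"
proof -
  have f': "A \<subseteq> topspace (mtop M)" "continuous_map (subtopology (mtop M) A) (mtop N) f"
    using f by (auto simp: smooth_on_iff)
  have "continuous_map (subtopology (mtop M) A) (subtopology (mtop N) B) f"
    using f' fB by (auto simp: continuous_map_in_subtopology)
  moreover have "continuous_map (subtopology (mtop N) B) (mtop P) g" using g by (simp add: smooth_on_iff)
  ultimately have "continuous_map (subtopology (mtop M) A) (mtop P) (g \<circ> f)" by (rule continuous_map_compose)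
  moreover have "Cr_in_charts r M A P (\<lambda>x. g (f x))" if "r \<noteq> C_top" "r \<noteq> C_fin 0"
    by (rule Cr_in_charts_compose[OF that(1) M N f' _ _ fB]) (use f g that in \<open>simp_all add: smooth_on_iff\<close>)
  ultimately show ?thesis using f' by (simp add: smooth_on_iff o_def)
qed

lemma smooth_on_subset:
  assumes "smooth_on r M A N f" "B \<subseteq> A"
  shows "smooth_on r M B N f"
proof -
  have "Cr_in_charts r M B N f" if "Cr_in_charts r M A N f"
    unfolding Cr_in_charts_def
  proof clarify
    fix U n \<phi> V m \<psi> assume "(U, n, \<phi>) \<in> atlas M" "(V, m, \<psi>) \<in> atlas N"
    from Cr_in_chartsD[OF that this]
    show "Cr_map r n m (\<phi> ` {x \<in> B \<inter> U. f x \<in> V}) (\<psi> \<circ> f \<circ> inv_into U \<phi>)"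
      by (rule Cr_map_subset) (use assms in auto)
  qed
  then show ?thesis
    using assms unfolding smooth_on_iff by (meson continuous_map_from_subtopology_mono order_trans)
qed

section \<open>Charts and submanifolds\<close>

lemma is_chartD:
  assumes "is_chart T (U, n, \<phi>)"
  shows "openin T U" "inj_on \<phi> U" "\<And>A. openin T A \<Longrightarrow> openin (Euclidean_space n) (\<phi> ` (U \<inter> A))"
    "\<phi> ` U \<subseteq> topspace (Euclidean_space n)"
proof -
  have c: "openin T U" "openin (Euclidean_space n) (\<phi> ` U)"
      "homeomorphic_map (subtopology T U) (subtopology (Euclidean_space n) (\<phi> ` U)) \<phi>"
    using assms by (auto simp: is_chart_def)
  show "openin T U" by fact
  have "topspace (subtopology T U) = U" using openin_subset[OF c(1)] by auto
  then show "inj_on \<phi> U" using c(3) homeomorphic_imp_injective_map by metis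
  show "\<phi> ` U \<subseteq> topspace (Euclidean_space n)" using openin_subset[OF c(2)] .
  fix A assume "openin T A"
  then have "openin (subtopology T U) (U \<inter> A)" using openin_subtopology_Int2 by blast
  then have "openin (subtopology (Euclidean_space n) (\<phi> ` U)) (\<phi> ` (U \<inter> A))"
    using homeomorphic_imp_open_map[OF c(3)] by (simp add: open_map_def)
  then show "openin (Euclidean_space n) (\<phi> ` (U \<inter> A))" using openin_open_subtopology[OF c(2)] by simp
qed

lemma manifold_charted: "manifold r M \<Longrightarrow> charted r M"
  unfolding manifold_def charted_def using is_chartD by fastforce

lemma is_chart_restrict:
  assumes c: "is_chart T (U, n, \<phi>)" and A: "openin T A"
  shows "is_chart T (U \<inter> A, n, \<phi>)"
proof -
  have h: "openin T U" "homeomorphic_map (subtopology T U) (subtopology (Euclidean_space n) (\<phi> ` U)) \<phi>"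
    using c by (auto simp: is_chart_def)
  have "topspace (subtopology T U) = U" using openin_subset[OF h(1)] by auto
  then have "homeomorphic_map (subtopology (subtopology T U) (U \<inter> A))
      (subtopology (subtopology (Euclidean_space n) (\<phi> ` U)) (\<phi> ` (U \<inter> A))) \<phi>"
    using is_chartD(4)[OF c] 
    by (intro homeomorphic_map_subtopologies[OF h(2)]) (use is_chartD(2)[OF c] in \<open>auto simp: inj_on_def\<close>)
  then have "homeomorphic_map (subtopology T (U \<inter> A)) (subtopology (Euclidean_space n) (\<phi> ` (U \<inter> A))) \<phi>"
    by (simp add: subtopology_subtopology image_Int_subset Int_absorb1 image_mono)
  then show ?thesis
    using is_chartD(3)[OF c A] h A by (simp add: is_chart_def openin_Int)
qed

lemma charts_restrict:
  assumes "(U, n, \<phi>) \<in> charts r M" "openin (mtop M) A"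
  shows "(U \<inter> A, n, \<phi>) \<in> charts r M"
proof -
  have c: "is_chart (mtop M) (U, n, \<phi>)" using assms by (simp add: charts_def)
  have inv: "inv_into U \<phi> (\<phi> x) = x" "inv_into (U \<inter> A) \<phi> (\<phi> x) = x" if "x \<in> U \<inter> A" for x
    using is_chartD(2)[OF c] that by (auto intro!: inv_into_f_f elim: inj_on_subset)
  have "compatible r (U \<inter> A, n, \<phi>) (V, m, \<psi>)" if "(V, m, \<psi>) \<in> atlas M" for V m \<psi>
  proof -
    have comp: "Cr_map r n m (\<phi> ` (U \<inter> V)) (\<psi> \<circ> inv_into U \<phi>)" "Cr_map r m n (\<psi> ` (U \<inter> V)) (\<phi> \<circ> inv_into V \<psi>)"
      using assms that by (auto simp: charts_def compatible_def)
    have "Cr_map r n m (\<phi> ` (U \<inter> A \<inter> V)) (\<psi> \<circ> inv_into U \<phi>)"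
      by (rule Cr_map_subset[OF comp(1)]) auto
    then have "Cr_map r n m (\<phi> ` (U \<inter> A \<inter> V)) (\<psi> \<circ> inv_into (U \<inter> A) \<phi>)"
      by (rule Cr_map_cong) (auto simp: inv)
    moreover have "Cr_map r m n (\<psi> ` (U \<inter> A \<inter> V)) (\<phi> \<circ> inv_into V \<psi>)"
      by (rule Cr_map_subset[OF comp(2)]) auto
    ultimately show ?thesis by (simp add: compatible_def)
  qed
  then show ?thesis using is_chart_restrict[OF c assms(2)] by (auto simp: charts_def)
qed

lemma slice_chartE:
  assumes "(V, k, \<phi>) \<in> slice_charts r M S"
  obtains U n where "V = U \<inter> S" "(U, n, \<phi>) \<in> charts r M" "k \<le> n"
    "\<phi> ` (U \<inter> S) = \<phi> ` U \<inter> topspace (Euclidean_space k)"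
  using assms unfolding slice_charts_def by blast

lemma Euclidean_space_subtopology:
  assumes "k \<le> n"
  shows "subtopology (Euclidean_space n) (topspace (Euclidean_space k)) = Euclidean_space k"
proof -
  have "{x. \<forall>i\<ge>n. x i = 0} \<inter> {x. \<forall>i\<ge>k. x i = 0} = {x :: nat \<Rightarrow> real. \<forall>i\<ge>k. x i = 0}" using assms by auto
  then show ?thesis unfolding topspace_Euclidean_space by (simp add: Euclidean_space_def subtopology_subtopology)
qed

text \<open>Since \<open>\<real>\<^sup>k\<close> is literally a subspace of \<open>\<real>\<^sup>n\<close> for \<open>k \<le> n\<close>, the restriction of a slice chart is a
  homeomorphism onto an open subset of \<open>\<real>\<^sup>k\<close> without any change of coordinates.\<close>

lemma slice_is_chart:
  assumes "(V, k, \<phi>) \<in> slice_charts r M S"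
  shows "is_chart (subtopology (mtop M) S) (V, k, \<phi>)"
proof -
  obtain U n where U: "V = U \<inter> S" "(U, n, \<phi>) \<in> charts r M" "k \<le> n"
    "\<phi> ` (U \<inter> S) = \<phi> ` U \<inter> topspace (Euclidean_space k)"
    using slice_chartE[OF assms] by metis
  have c: "is_chart (mtop M) (U, n, \<phi>)" using U by (simp add: charts_def)
  then have h: "openin (mtop M) U" "openin (Euclidean_space n) (\<phi> ` U)"
     "homeomorphic_map (subtopology (mtop M) U) (subtopology (Euclidean_space n) (\<phi> ` U)) \<phi>"
    by (auto simp: is_chart_def)
  have top: "topspace (subtopology (mtop M) U) = U" using openin_subset[OF h(1)] by auto
  have "homeomorphic_map (subtopology (subtopology (mtop M) U) V)
      (subtopology (subtopology (Euclidean_space n) (\<phi> ` U)) (\<phi> ` V)) \<phi>"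
    by (intro homeomorphic_map_subtopologies[OF h(3)])
       (use is_chartD(2,4)[OF c] top U(1) in \<open>auto simp: inj_on_def\<close>)
  moreover have "subtopology (subtopology (mtop M) U) V = subtopology (subtopology (mtop M) S) V"
    using U by (simp add: subtopology_subtopology Int_commute Int_left_commute)
  moreover have "\<phi> ` U \<inter> \<phi> ` V = topspace (Euclidean_space k) \<inter> \<phi> ` V" using U by blast
  then have "subtopology (subtopology (Euclidean_space n) (\<phi> ` U)) (\<phi> ` V)
      = subtopology (Euclidean_space k) (\<phi> ` V)"
    by (metis Euclidean_space_subtopology[OF U(3)] subtopology_subtopology)
  moreover have "openin (Euclidean_space k) (\<phi> ` V)"
    using openin_subtopology_Int[OF h(2), of "topspace (Euclidean_space k)"]
      Euclidean_space_subtopology[OF U(3)] U(1,4) by simp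
  moreover have "openin (subtopology (mtop M) S) V"
    using openin_subtopology_Int[OF h(1)] U(1) by simp
  ultimately show ?thesis by (simp add: is_chart_def)
qed

lemma mtop_submfd [simp]: "mtop (submfd r M S) = subtopology (mtop M) S"
  and atlas_submfd [simp]: "atlas (submfd r M S) = slice_charts r M S"
  by (simp_all add: submfd_def)

lemma charted_submfd:
  assumes "submanifold r M S"
  shows "charted r (submfd r M S)"
proof (cases "r = C_top")
  case False
  have "\<forall>(U, n, \<phi>)\<in>slice_charts r M S. openin (subtopology (mtop M) S) U \<and> inj_on \<phi> U \<and>
        (\<forall>T. openin (subtopology (mtop M) S) T \<longrightarrow> openin (Euclidean_space n) (\<phi> ` (U \<inter> T)))"
    using is_chartD(1-3)[OF slice_is_chart] by blast
  moreover have "topspace (subtopology (mtop M) S) \<subseteq> \<Union>(fst ` slice_charts r M S)"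
    using assms False unfolding submanifold_def by auto
  ultimately show ?thesis unfolding charted_def by simp
qed (simp add: charted_def)

text \<open>In a slice chart and a chart of \<open>M\<close> the inclusion of \<open>S\<close> is the inclusion \<open>\<real>\<^sup>k \<rightarrow> \<real>\<^sup>n\<close> followed by a
  transition map.\<close>

lemma Cr_in_charts_inclusion: "Cr_in_charts r (submfd r M S) A M (\<lambda>x. x)"
  unfolding Cr_in_charts_def
proof clarify
  fix V k \<phi> W m \<psi> assume "(V, k, \<phi>) \<in> atlas (submfd r M S)" and W: "(W, m, \<psi>) \<in> atlas M"
  then have V: "(V, k, \<phi>) \<in> slice_charts r M S" by simp
  obtain U n where U: "V = U \<inter> S" "(U, n, \<phi>) \<in> charts r M" "k \<le> n"
    "\<phi> ` (U \<inter> S) = \<phi> ` U \<inter> topspace (Euclidean_space k)"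
    using slice_chartE[OF V] by metis
  have c: "is_chart (mtop M) (U, n, \<phi>)" "compatible r (U, n, \<phi>) (W, m, \<psi>)" using U W by (auto simp: charts_def)
  have inv: "inv_into U \<phi> (\<phi> x) = x" "inv_into V \<phi> (\<phi> x) = x" if "x \<in> V" for x
    using is_chartD(2)[OF c(1)] that U(1) by (auto intro!: inv_into_f_f elim: inj_on_subset)
  let ?S = "\<phi> ` {x \<in> A \<inter> V. x \<in> W}"
  have "Cr_map r k n ?S (\<lambda>x. x)"
  proof (rule Cr_map_coordinates)
    show S: "?S \<subseteq> topspace (Euclidean_space k)" using U by blast
    show "(\<exists>j<k. \<forall>x\<in>?S. x i = x j) \<or> (\<forall>x\<in>?S. x i = 0)" for i
      using S by (cases "i < k") (force simp: topspace_Euclidean_space)+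
  qed
  moreover have "Cr_map r n m (\<phi> ` (U \<inter> W)) (\<psi> \<circ> inv_into U \<phi>)" using c(2) by (simp add: compatible_def)
  ultimately have "Cr_map r k m ?S (\<lambda>x. (\<psi> \<circ> inv_into U \<phi>) x)"
    by (rule Cr_map_compose) (use U(1) is_chartD(4)[OF c(1)] in auto)
  then show "Cr_map r k m ?S (\<psi> \<circ> (\<lambda>x. x) \<circ> inv_into V \<phi>)"
    by (rule Cr_map_cong) (auto simp: inv)
qed

text \<open>In a chart of \<open>M\<close> and a slice chart the identity is a transition map of which only the first \<open>k\<close>
  coordinates are kept. This and the inclusion are how smoothness is transported between \<open>M\<close> and its
  submanifolds, however their atlases were obtained.\<close>

lemma Cr_in_charts_corestrict: "Cr_in_charts r M A (submfd r M S) (\<lambda>x. x)"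
  unfolding Cr_in_charts_def
proof clarify
  fix V k \<phi> W m \<psi> assume W: "(W, m, \<psi>) \<in> atlas M" and "(V, k, \<phi>) \<in> atlas (submfd r M S)"
  then have V: "(V, k, \<phi>) \<in> slice_charts r M S" by simp
  obtain U n where U: "V = U \<inter> S" "(U, n, \<phi>) \<in> charts r M" "k \<le> n"
    using slice_chartE[OF V] by metis
  have "Cr_map r m n (\<psi> ` (U \<inter> W)) (\<phi> \<circ> inv_into W \<psi>)" using U W by (auto simp: charts_def compatible_def)
  then show "Cr_map r m k (\<psi> ` {x \<in> A \<inter> W. x \<in> V}) (\<phi> \<circ> (\<lambda>x. x) \<circ> inv_into W \<psi>)"
    by (rule Cr_map_mono) (use U in auto)
qed

lemma smooth_on_inclusion:
  assumes "A \<subseteq> S" "S \<subseteq> topspace (mtop M)"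
  shows "smooth_on r (submfd r M S) A M (\<lambda>x. x)"
  using assms Cr_in_charts_inclusion unfolding smooth_on_iff
  by (auto intro!: continuous_map_from_subtopology)

lemma smooth_on_corestrict:
  assumes "A \<subseteq> S" "A \<subseteq> topspace (mtop M)"
  shows "smooth_on r M A (submfd r M S) (\<lambda>x. x)"
  using assms Cr_in_charts_corestrict unfolding smooth_on_iff
  by (auto simp: continuous_map_in_subtopology)

text \<open>Transition maps between slice charts are the identity of \<open>S\<close> in these charts, which factors as
  \<open>S \<rightarrow> M \<rightarrow> S\<close> and is \<open>C\<^sup>r\<close> by composition.\<close>

lemma manifold_submfd:
  assumes M: "manifold r M" and S: "submanifold r M S"
  shows "manifold r (submfd r M S)"
proof (cases "r = C_top")
  case False
  have sub: "S \<subseteq> topspace (mtop M)" using S by (simp add: submanifold_def)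
  have "Cr_in_charts r (submfd r M S) S (submfd r M S) (\<lambda>x. x)"
    by (rule Cr_in_charts_compose[OF False charted_submfd[OF S] manifold_charted[OF M] _ _
          Cr_in_charts_inclusion Cr_in_charts_corestrict subset_UNIV])
       (use sub in \<open>auto intro!: continuous_map_from_subtopology\<close>)
  then have id: "Cr_map r n m (\<phi> ` {x \<in> S \<inter> U. x \<in> V}) (\<psi> \<circ> inv_into U \<phi>)"
    if "(U, n, \<phi>) \<in> slice_charts r M S" "(V, m, \<psi>) \<in> slice_charts r M S" for U n \<phi> V m \<psi>
    using Cr_in_chartsD[of r "submfd r M S" S "submfd r M S" "\<lambda>x. x"] that by (force simp: comp_def)
  have inS: "U \<subseteq> S" if "(U, n, \<phi>) \<in> slice_charts r M S" for U n \<phi>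
    using slice_chartE[OF that] by blast
  have "compatible r (U, n, \<phi>) (V, m, \<psi>)"
    if "(U, n, \<phi>) \<in> slice_charts r M S" "(V, m, \<psi>) \<in> slice_charts r M S" for U n \<phi> V m \<psi>
  proof -
    have "{x \<in> S \<inter> U. x \<in> V} = U \<inter> V" "{x \<in> S \<inter> V. x \<in> U} = U \<inter> V" using inS that by blast+
    then show ?thesis using id[OF that] id[OF that(2,1)] by (simp add: compatible_def)
  qed
  then have comp: "\<forall>c\<in>slice_charts r M S. \<forall>d\<in>slice_charts r M S. compatible r c d" by auto
  have ch: "\<forall>c\<in>slice_charts r M S. is_chart (subtopology (mtop M) S) c" using slice_is_chart by auto
  have "\<Union>(fst ` slice_charts r M S) \<subseteq> S" using inS by force
  then have "\<Union>(fst ` slice_charts r M S) = topspace (subtopology (mtop M) S)"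
    using S False sub unfolding submanifold_def by auto
  then show ?thesis
    using M False comp ch unfolding manifold_def
    by (simp add: Hausdorff_space_subtopology second_countable_subtopology)
qed (simp add: manifold_def)

text \<open>A slice chart of \<open>W\<close> restricts to a slice chart of the open subset \<open>H\<close>. So a chart that is compatible
  with all slice charts of \<open>H\<close> is compatible with those of \<open>W\<close>: its domain lies in \<open>H\<close>, where
  the two kinds of slice charts agree.\<close>

lemma charts_open_submfd:
  assumes HW: "H \<subseteq> W" and H: "openin (subtopology (mtop M) W) H"
  shows "charts r (submfd r M H) \<subseteq> charts r (submfd r M W)"
proof clarify
  fix V n \<psi> assume V: "(V, n, \<psi>) \<in> charts r (submfd r M H)"
  obtain T where T: "openin (mtop M) T" "H = T \<inter> W" using H by (auto simp: openin_subtopology)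
  have top: "subtopology (mtop M) H = subtopology (subtopology (mtop M) W) H"
    using HW by (simp add: subtopology_subtopology Int_absorb1)
  have c: "is_chart (subtopology (mtop M) H) (V, n, \<psi>)" using V by (simp add: charts_def)
  have VH: "V \<subseteq> H" using openin_subset[OF is_chartD(1)[OF c]] by simp
  have "is_chart (subtopology (mtop M) W) (V, n, \<psi>)"
  proof -
    have "subtopology (subtopology (mtop M) H) V = subtopology (subtopology (mtop M) W) V"
      using VH HW by (simp add: subtopology_subtopology Int_absorb1)
    moreover have "openin (subtopology (mtop M) W) V"
      using is_chartD(1)[OF c] H openin_trans_full unfolding top by blast
    ultimately show ?thesis using c by (simp add: is_chart_def)
  qed
  moreover have "compatible r (V, n, \<psi>) (A, k, \<phi>)" if A: "(A, k, \<phi>) \<in> slice_charts r M W" for A k \<phi>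
  proof -
    obtain U m where U: "A = U \<inter> W" "(U, m, \<phi>) \<in> charts r M" "k \<le> m"
      "\<phi> ` (U \<inter> W) = \<phi> ` U \<inter> topspace (Euclidean_space k)"
      using slice_chartE[OF A] by metis
    have UT: "(U \<inter> T, m, \<phi>) \<in> charts r M" by (rule charts_restrict[OF U(2) T(1)])
    have inj: "inj_on \<phi> U" using U(2) is_chartD(2) unfolding charts_def by blast
    have "\<phi> ` (U \<inter> T \<inter> H) = \<phi> ` (U \<inter> T) \<inter> topspace (Euclidean_space k)"
    proof
      show "\<phi> ` (U \<inter> T \<inter> H) \<subseteq> \<phi> ` (U \<inter> T) \<inter> topspace (Euclidean_space k)" using U T by blast
      show "\<phi> ` (U \<inter> T) \<inter> topspace (Euclidean_space k) \<subseteq> \<phi> ` (U \<inter> T \<inter> H)"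
      proof clarify
        fix x assume x: "x \<in> U" "x \<in> T" "\<phi> x \<in> topspace (Euclidean_space k)"
        then obtain y where "y \<in> U \<inter> W" "\<phi> x = \<phi> y" using U(4) by blast
        then have "x \<in> W" using inj x unfolding inj_on_def by blast
        then show "\<phi> x \<in> \<phi> ` (U \<inter> T \<inter> H)" using x T by blast
      qed
    qed
    moreover have AH: "A \<inter> H = U \<inter> T \<inter> H" using U T by blast
    ultimately have "(A \<inter> H, k, \<phi>) \<in> slice_charts r M H"
      using UT U(3) unfolding slice_charts_def by blast
    then have comp: "compatible r (V, n, \<psi>) (A \<inter> H, k, \<phi>)" using V by (simp add: charts_def)
    have "inj_on \<phi> A" using inj U(1) by (auto elim: inj_on_subset)
    then have inv: "inv_into A \<phi> (\<phi> x) = x" "inv_into (A \<inter> H) \<phi> (\<phi> x) = x" if "x \<in> A \<inter> H" for x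
      using that by (auto intro!: inv_into_f_f elim: inj_on_subset)
    have VA: "V \<inter> (A \<inter> H) = V \<inter> A" using VH by blast
    have "Cr_map r k n (\<phi> ` (V \<inter> A)) (\<psi> \<circ> inv_into (A \<inter> H) \<phi>)"
      using comp VA by (simp add: compatible_def)
    then have "Cr_map r k n (\<phi> ` (V \<inter> A)) (\<psi> \<circ> inv_into A \<phi>)"
      by (rule Cr_map_cong) (use VH inv in auto)
    then show ?thesis using comp VA by (simp add: compatible_def)
  qed
  ultimately show "(V, n, \<psi>) \<in> charts r (submfd r M W)" by (auto simp: charts_def)
qed

section \<open>Products of manifolds\<close>

lemma prod_mfd_simps [simp]:
  "mtop (prod_mfd M N) = prod_topology (mtop M) (mtop N)"
  "atlas (prod_mfd M N) = {(U \<times> V, n + m, \<lambda>(x, y) i. if i < n then \<phi> x i else \<psi> y (i - n)) | U n \<phi> V m \<psi>.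
       (U, n, \<phi>) \<in> atlas M \<and> (V, m, \<psi>) \<in> atlas N}"
  by (simp_all add: prod_mfd_def)

text \<open>The two projections of \<open>\<real>\<^bsup>n+m\<^esup>\<close> and the inverse pairing, in which product charts are written.\<close>

definition first_coords :: "nat \<Rightarrow> (nat \<Rightarrow> real) \<Rightarrow> nat \<Rightarrow> real" where
  "first_coords n z = (\<lambda>i. if i < n then z i else 0)"

definition last_coords :: "nat \<Rightarrow> nat \<Rightarrow> (nat \<Rightarrow> real) \<Rightarrow> nat \<Rightarrow> real" where
  "last_coords n m z = (\<lambda>i. if i < m then z (n + i) else 0)"

definition join_coords :: "nat \<Rightarrow> (nat \<Rightarrow> real) \<Rightarrow> (nat \<Rightarrow> real) \<Rightarrow> nat \<Rightarrow> real" where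
  "join_coords n a b = (\<lambda>i. if i < n then a i else b (i - n))"

lemma join_coords_in:
  "b \<in> topspace (Euclidean_space m) \<Longrightarrow> join_coords n a b \<in> topspace (Euclidean_space (n + m))"
  by (auto simp: topspace_Euclidean_space join_coords_def)

lemma first_join: "a \<in> topspace (Euclidean_space n) \<Longrightarrow> first_coords n (join_coords n a b) = a"
  by (auto simp: topspace_Euclidean_space join_coords_def first_coords_def)

lemma last_join: "b \<in> topspace (Euclidean_space m) \<Longrightarrow> last_coords n m (join_coords n a b) = b"
  by (auto simp: topspace_Euclidean_space join_coords_def last_coords_def)

lemma join_first_last:
  "z \<in> topspace (Euclidean_space (n + m)) \<Longrightarrow> join_coords n (first_coords n z) (last_coords n m z) = z"
  by (rule ext) (auto simp: topspace_Euclidean_space join_coords_def first_coords_def last_coords_def)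

lemma continuous_first_coords: "continuous_map (Euclidean_space l) (Euclidean_space n) (first_coords n)"
  and continuous_last_coords: "continuous_map (Euclidean_space l) (Euclidean_space m) (last_coords n m)"
  unfolding first_coords_def [abs_def] last_coords_def [abs_def]
  by (simp_all add: continuous_map_componentwise_Euclidean_space continuous_map_coordinate)

lemma Cr_map_first_coords:
  assumes "S \<subseteq> topspace (Euclidean_space (n + m))"
  shows "Cr_map r (n + m) n S (first_coords n)"
proof (rule Cr_map_coordinates[OF assms])
  fix i assume "i < n"
  then show "(\<exists>j<n + m. \<forall>x\<in>S. first_coords n x i = x j) \<or> (\<forall>x\<in>S. first_coords n x i = 0)"
    by (intro disjI1 exI[of _ i]) (simp add: first_coords_def)
qed

lemma Cr_map_last_coords:
  assumes "S \<subseteq> topspace (Euclidean_space (n + m))"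
  shows "Cr_map r (n + m) m S (last_coords n m)"
proof (rule Cr_map_coordinates[OF assms])
  fix i assume "i < m"
  then show "(\<exists>j<n + m. \<forall>x\<in>S. last_coords n m x i = x j) \<or> (\<forall>x\<in>S. last_coords n m x i = 0)"
    by (intro disjI1 exI[of _ "n + i"]) (simp add: last_coords_def)
qed

lemma atlas_prodE:
  assumes "(P, l, \<xi>) \<in> atlas (prod_mfd M N)"
  obtains U n \<phi> V m \<psi> where "(U, n, \<phi>) \<in> atlas M" "(V, m, \<psi>) \<in> atlas N"
    "P = U \<times> V" "l = n + m" "\<xi> = (\<lambda>(x, y). join_coords n (\<phi> x) (\<psi> y))"
  using assms unfolding prod_mfd_simps join_coords_def by blast

lemma atlas_prodI:
  assumes "(U, n, \<phi>) \<in> atlas M" "(V, m, \<psi>) \<in> atlas N"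
  shows "(U \<times> V, n + m, \<lambda>(x, y). join_coords n (\<phi> x) (\<psi> y)) \<in> atlas (prod_mfd M N)"
  using assms unfolding prod_mfd_simps join_coords_def by blast

lemma charted_prod:
  assumes M: "charted r M" and N: "charted r N"
  shows "charted r (prod_mfd M N)"
proof (cases "r = C_top")
  case r: False
  have chart: "openin (mtop (prod_mfd M N)) P \<and> inj_on \<xi> P \<and>
        (\<forall>T. openin (mtop (prod_mfd M N)) T \<longrightarrow> openin (Euclidean_space l) (\<xi> ` (P \<inter> T)))"
    if P: "(P, l, \<xi>) \<in> atlas (prod_mfd M N)" for P l \<xi>
  proof -
    obtain U n \<phi> V m \<psi> where U: "(U, n, \<phi>) \<in> atlas M" and V: "(V, m, \<psi>) \<in> atlas N"
      and eq: "P = U \<times> V" "l = n + m" "\<xi> = (\<lambda>(x, y). join_coords n (\<phi> x) (\<psi> y))"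
      using P by (rule atlas_prodE)
    note U' = charted_chartD[OF M r U] and V' = charted_chartD[OF N r V]
    have E: "\<phi> x \<in> topspace (Euclidean_space n)" "\<psi> y \<in> topspace (Euclidean_space m)"
      if "x \<in> U" "y \<in> V" for x y using that U'(4) V'(4) by blast+
    have fl: "first_coords n (\<xi> (x, y)) = \<phi> x" "last_coords n m (\<xi> (x, y)) = \<psi> y"
      if "x \<in> U" "y \<in> V" for x y
      using E[OF that] by (simp_all add: eq first_join last_join)
    have "inj_on \<xi> P"
    proof (rule inj_onI, clarsimp simp: eq(1))
      fix x y x' y' assume "x \<in> U" "y \<in> V" "x' \<in> U" "y' \<in> V" "\<xi> (x, y) = \<xi> (x', y')"
      then have "\<phi> x = \<phi> x'" "\<psi> y = \<psi> y'" using fl by metis+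
      then show "x = x' \<and> y = y'"
        using U'(2) V'(2) \<open>x \<in> U\<close> \<open>y \<in> V\<close> \<open>x' \<in> U\<close> \<open>y' \<in> V\<close> by (auto dest: inj_onD)
    qed
    moreover have "openin (Euclidean_space l) (\<xi> ` (P \<inter> T))"
      if T: "openin (mtop (prod_mfd M N)) T" for T
    proof (subst openin_subopen, intro ballI)
      fix p assume "p \<in> \<xi> ` (P \<inter> T)"
      then obtain x y where p: "p = \<xi> (x, y)" and xy: "x \<in> U" "y \<in> V" "(x, y) \<in> T" using eq by auto
      obtain A B where A: "openin (mtop M) A" "x \<in> A" and B: "openin (mtop N) B" "y \<in> B"
        and AB: "A \<times> B \<subseteq> T"
        using T xy(3) unfolding prod_mfd_simps openin_prod_topology_alt by blast
      let ?A = "{z \<in> topspace (Euclidean_space l). first_coords n z \<in> \<phi> ` (U \<inter> A)}"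
      let ?B = "{z \<in> topspace (Euclidean_space l). last_coords n m z \<in> \<psi> ` (V \<inter> B)}"
      have "openin (Euclidean_space l) (?A \<inter> ?B)"
        by (intro openin_Int openin_continuous_map_preimage[OF continuous_first_coords]
            openin_continuous_map_preimage[OF continuous_last_coords] U'(3) V'(3) A B)
      moreover have "p \<in> ?A \<inter> ?B"
      proof -
        have "p \<in> topspace (Euclidean_space l)"
          using join_coords_in[OF E(2)[OF xy(1,2)]] by (simp add: p eq)
        then show ?thesis using fl[OF xy(1,2)] xy A B by (simp add: p)
      qed
      moreover have "?A \<inter> ?B \<subseteq> \<xi> ` (P \<inter> T)"
      proof
        fix z assume "z \<in> ?A \<inter> ?B"
        then obtain x' y' where z: "z \<in> topspace (Euclidean_space l)"
            "first_coords n z = \<phi> x'" "last_coords n m z = \<psi> y'" "x' \<in> U \<inter> A" "y' \<in> V \<inter> B" by auto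
        then have "z = \<xi> (x', y')" using join_first_last[of z n m] by (simp add: eq)
        then show "z \<in> \<xi> ` (P \<inter> T)" using z(4,5) AB eq(1) by auto
      qed
      ultimately show "\<exists>T'. openin (Euclidean_space l) T' \<and> p \<in> T' \<and> T' \<subseteq> \<xi> ` (P \<inter> T)" by blast
    qed
    moreover have "openin (mtop (prod_mfd M N)) P"
      using U'(1) V'(1) by (simp add: eq openin_prod_Times_iff)
    ultimately show ?thesis by blast
  qed
  have "z \<in> \<Union>(fst ` atlas (prod_mfd M N))" if z: "z \<in> topspace (mtop (prod_mfd M N))" for z
  proof -
    obtain x y where z': "z = (x, y)" "x \<in> topspace (mtop M)" "y \<in> topspace (mtop N)" using z by auto
    obtain U n \<phi> where U: "(U, n, \<phi>) \<in> atlas M" "x \<in> U" using z'(2) by (rule charted_cover[OF M r])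
    obtain V m \<psi> where V: "(V, m, \<psi>) \<in> atlas N" "y \<in> V" using z'(3) by (rule charted_cover[OF N r])
    from atlas_prodI[OF U(1) V(1)] have "U \<times> V \<in> fst ` atlas (prod_mfd M N)" by (rule rev_image_eqI) simp
    then show ?thesis using U V z' by blast
  qed
  with chart show ?thesis unfolding charted_def by auto
qed (simp add: charted_def)

text \<open>In product charts the map is \<open>f\<close> in charts after the first projection, paired with \<open>g\<close> in charts after
  the second.\<close>

lemma Cr_in_charts_map_prod:
  assumes r: "r \<noteq> C_top" and M: "charted r M" and N: "charted r N"
    and f: "Cr_in_charts r M A M' f" and g: "Cr_in_charts r N B N' g"
  shows "Cr_in_charts r (prod_mfd M N) (A \<times> B) (prod_mfd M' N') (map_prod f g)"
  unfolding Cr_in_charts_def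
proof clarify
  fix P l \<xi> P' l' \<xi>'
  assume P: "(P, l, \<xi>) \<in> atlas (prod_mfd M N)" and P': "(P', l', \<xi>') \<in> atlas (prod_mfd M' N')"
  obtain U n \<phi> V m \<psi> where U: "(U, n, \<phi>) \<in> atlas M" and V: "(V, m, \<psi>) \<in> atlas N"
    and eq: "P = U \<times> V" "l = n + m" "\<xi> = (\<lambda>(x, y). join_coords n (\<phi> x) (\<psi> y))"
    using P by (rule atlas_prodE)
  obtain U' n' \<phi>' V' m' \<psi>' where U': "(U', n', \<phi>') \<in> atlas M'" and V': "(V', m', \<psi>') \<in> atlas N'"
    and eq': "P' = U' \<times> V'" "l' = n' + m'" "\<xi>' = (\<lambda>(x, y). join_coords n' (\<phi>' x) (\<psi>' y))"
    using P' by (rule atlas_prodE)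
  note cU = charted_chartD[OF M r U] and cV = charted_chartD[OF N r V]
  note cP = charted_chartD[OF charted_prod[OF M N] r P]
  have E: "\<phi> x \<in> topspace (Euclidean_space n)" "\<psi> y \<in> topspace (Euclidean_space m)"
    if "x \<in> U" "y \<in> V" for x y using that cU(4) cV(4) by blast+
  have fl: "first_coords n (\<xi> (x, y)) = \<phi> x" "last_coords n m (\<xi> (x, y)) = \<psi> y"
    if "x \<in> U" "y \<in> V" for x y
    using E[OF that] by (simp_all add: eq first_join last_join)
  let ?S = "\<xi> ` {z \<in> A \<times> B \<inter> P. map_prod f g z \<in> P'}"
  have S: "?S \<subseteq> topspace (Euclidean_space (n + m))" using cP(4) eq(2) by blast
  let ?f = "\<phi>' \<circ> f \<circ> inv_into U \<phi>" and ?g = "\<psi>' \<circ> g \<circ> inv_into V \<psi>"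
  have 1: "Cr_map r (n + m) n' ?S (\<lambda>z. ?f (first_coords n z))"
  proof (rule Cr_map_compose[OF Cr_map_first_coords[OF S] Cr_in_chartsD[OF f U U']])
    show "first_coords n p \<in> \<phi> ` {x \<in> A \<inter> U. f x \<in> U'}" if p: "p \<in> ?S" for p
    proof -
      obtain x y where "p = \<xi> (x, y)" "x \<in> U" "y \<in> V" "x \<in> A" "f x \<in> U'"
        using p by (auto simp: eq(1) eq'(1))
      then show ?thesis by (simp add: fl)
    qed
  qed (use cU(4) in blast)
  have 2: "Cr_map r (n + m) m' ?S (\<lambda>z. ?g (last_coords n m z))"
  proof (rule Cr_map_compose[OF Cr_map_last_coords[OF S] Cr_in_chartsD[OF g V V']])
    show "last_coords n m p \<in> \<psi> ` {y \<in> B \<inter> V. g y \<in> V'}" if p: "p \<in> ?S" for p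
    proof -
      obtain x y where "p = \<xi> (x, y)" "x \<in> U" "y \<in> V" "y \<in> B" "g y \<in> V'"
        using p by (auto simp: eq(1) eq'(1))
      then show ?thesis by (simp add: fl)
    qed
  qed (use cV(4) in blast)
  have "Cr_map r (n + m) (n' + m') ?S (\<xi>' \<circ> map_prod f g \<circ> inv_into P \<xi>)"
  proof (rule Cr_map_cong[OF Cr_map_pair[OF 1 2]])
    fix p i assume "p \<in> ?S"
    then obtain x y where p: "p = \<xi> (x, y)" and xy: "x \<in> U" "y \<in> V" by (auto simp: eq(1))
    have "inv_into P \<xi> p = (x, y)" using cP(2) xy by (simp add: p eq(1))
    moreover have "inv_into U \<phi> (\<phi> x) = x" "inv_into V \<psi> (\<psi> y) = y" using cU(2) cV(2) xy by simp_all
    ultimately show "(if i < n' then ?f (first_coords n p) i else ?g (last_coords n m p) (i - n'))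
        = (\<xi>' \<circ> map_prod f g \<circ> inv_into P \<xi>) p i"
      using fl[OF xy] by (simp add: p eq'(3) join_coords_def)
  qed
  then show "Cr_map r l l' ?S (\<xi>' \<circ> map_prod f g \<circ> inv_into P \<xi>)" by (simp add: eq(2) eq'(2))
qed

lemma smooth_on_map_prod:
  assumes M: "charted r M" and N: "charted r N"
    and f: "smooth_on r M A M' f" and g: "smooth_on r N B N' g"
  shows "smooth_on r (prod_mfd M N) (A \<times> B) (prod_mfd M' N') (map_prod f g)"
proof -
  have "continuous_map (prod_topology (subtopology (mtop M) A) (subtopology (mtop N) B))
      (prod_topology (mtop M') (mtop N')) (\<lambda>(x, y). (f x, g y))"
    using f g by (intro continuous_map_prod_top[THEN iffD2]) (simp add: smooth_on_iff)
  then have "continuous_map (subtopology (mtop (prod_mfd M N)) (A \<times> B)) (mtop (prod_mfd M' N')) (map_prod f g)"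
    by (simp add: subtopology_Times map_prod_def)
  moreover have "A \<times> B \<subseteq> topspace (mtop (prod_mfd M N))" using f g by (auto simp: smooth_on_iff)
  moreover have "Cr_in_charts r (prod_mfd M N) (A \<times> B) (prod_mfd M' N') (map_prod f g)"
    if "r \<noteq> C_top" "r \<noteq> C_fin 0"
    using f g that by (intro Cr_in_charts_map_prod[OF that(1) M N]) (simp_all only: smooth_on_iff simp_thms)
  ultimately show ?thesis unfolding smooth_on_iff by blast
qed

text \<open>Factor as inclusion of \<open>S\<close>, then \<open>f\<close>, then corestriction to \<open>S'\<close>.\<close>

lemma smooth_on_submfds:
  assumes M: "manifold r M" and N: "manifold r N" and S: "submanifold r M S"
    and f: "smooth_on r M A N f" and "A \<subseteq> S" "f ` A \<subseteq> S'"
  shows "smooth_on r (submfd r M S) A (submfd r N S') f"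
proof -
  have S': "S \<subseteq> topspace (mtop M)" using S by (simp add: submanifold_def)
  have "A \<subseteq> topspace (mtop M)" "f ` A \<subseteq> topspace (mtop N)"
    using f by (auto simp: smooth_on_iff continuous_map_def)
  then have "smooth_on r M A (submfd r N S') (\<lambda>x. (f x))"
    using smooth_on_compose[OF manifold_charted[OF M] manifold_charted[OF N] f smooth_on_corestrict[OF assms(6)]]
    by simp
  then show ?thesis
    using smooth_on_compose[OF charted_submfd[OF S] manifold_charted[OF M] smooth_on_inclusion[OF assms(5) S']]
    by fastforce
qed

text \<open>Objects form a submanifold of a submanifold, and the manifolds of arrows in question are different
  submanifolds of the same \<open>M\<close>. Passing through \<open>M\<close> shows that the structures obtained on a common
  subset of objects agree.\<close>

lemma smooth_on_id_nested:
  assumes M: "manifold r M" and S: "submanifold r M S" and T: "submanifold r M T"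
    and S': "submanifold r (submfd r M S) S'" and A: "A \<subseteq> S" "A \<subseteq> S'" "A \<subseteq> T" "A \<subseteq> T'"
  shows "smooth_on r (submfd r (submfd r M S) S') A (submfd r (submfd r M T) T') (\<lambda>x. x)"
proof -
  have sub: "S \<subseteq> topspace (mtop M)" "T \<subseteq> topspace (mtop M)" "S' \<subseteq> topspace (mtop (submfd r M S))"
    using S T S' by (auto simp: submanifold_def)
  note cM = manifold_charted[OF M] and cS = charted_submfd[OF S] and cT = charted_submfd[OF T]
    and cS' = charted_submfd[OF S']
  have 1: "smooth_on r (submfd r (submfd r M S) S') A (submfd r M S) (\<lambda>x. x)"
    by (rule smooth_on_inclusion[OF A(2) sub(3)])
  have 2: "smooth_on r (submfd r (submfd r M S) S') A M (\<lambda>x. x)"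
    using smooth_on_compose[OF cS' cS 1 smooth_on_inclusion[OF A(1) sub(1)]] by simp
  have 3: "smooth_on r (submfd r (submfd r M S) S') A (submfd r M T) (\<lambda>x. x)"
    using smooth_on_compose[OF cS' cM 2 smooth_on_corestrict[OF A(3)]] A sub by auto
  have "smooth_on r (submfd r M T) A (submfd r (submfd r M T) T') (\<lambda>x. x)"
    by (rule smooth_on_corestrict[OF A(4)]) (use A sub in auto)
  from smooth_on_compose[OF cS' cT 3 this] show ?thesis by simp
qed

section \<open>Subgroupoids\<close>

lemma sub_gpd_simps [simp]:
  "arrows (sub_gpd G H) = H" "src (sub_gpd G H) = src G" "tgt (sub_gpd G H) = tgt G"
  "gmul (sub_gpd G H) = gmul G" "ginv (sub_gpd G H) = ginv G"
  by (simp_all add: sub_gpd_def)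

lemma src_pairs_sub_gpd [simp]: "src_pairs (sub_gpd G H) A = src_pairs G A"
  and delta_sub_gpd [simp]: "delta (sub_gpd G H) = delta G"
  and delta_dom_sub_gpd [simp]: "delta_dom (sub_gpd G H) A = delta_dom G A"
  by (simp_all add: src_pairs_def delta_def delta_dom_def)

lemma (in groupoid) objD:
  assumes "x \<in> objs G"
  shows "x \<in> arrows G" "src G x = x" "tgt G x = x"
  using assms src_closed src_src tgt_src by (auto simp: objs_def)

lemma (in groupoid) inv_inv:
  assumes g: "g \<in> arrows G"
  shows "ginv G (ginv G g) = g"
proof -
  note gA = g inv_closed[OF g] inv_closed[OF inv_closed[OF g]]
  have "ginv G (ginv G g) = gmul G (src G g) (ginv G (ginv G g))"
    using mul_src[OF gA(3)] gA by (simp add: src_inv tgt_inv)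
  also have "\<dots> = gmul G g (gmul G (ginv G g) (ginv G (ginv G g)))"
    using mul_assoc[OF gA] gA by (simp add: src_inv tgt_inv mul_inv)
  also have "\<dots> = g" using gA by (simp add: mul_inv src_inv mul_tgt)
  finally show ?thesis .
qed

lemma groupoid_sub_gpd:
  assumes "groupoid G" "subgroupoid G H"
  shows "groupoid (sub_gpd G H)"
proof -
  interpret groupoid G by fact
  have H: "H \<subseteq> arrows G" "\<And>g. g \<in> H \<Longrightarrow> src G g \<in> H" "\<And>g. g \<in> H \<Longrightarrow> tgt G g \<in> H"
    "\<And>g. g \<in> H \<Longrightarrow> ginv G g \<in> H" "\<And>u v. u \<in> H \<Longrightarrow> v \<in> H \<Longrightarrow> tgt G u = src G v \<Longrightarrow> gmul G u v \<in> H"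
    using assms(2) unfolding subgroupoid_def by blast+
  note [simp] = subsetD[OF H(1)]
  show ?thesis
    by unfold_locales (simp_all add: H src_src tgt_src src_tgt tgt_tgt src_mul tgt_mul mul_assoc
        mul_src mul_tgt src_inv tgt_inv mul_inv inv_mul)
qed

lemma (in groupoid) subgroupoid_arrows: "subgroupoid G (arrows G)"
  unfolding subgroupoid_def using src_closed tgt_closed inv_closed mul_closed by auto

lemma generated_subgroupoid_iff:
  "x \<in> generated_subgroupoid G A \<longleftrightarrow> (\<forall>H. subgroupoid G H \<and> A \<subseteq> H \<longrightarrow> x \<in> H)"
  unfolding generated_subgroupoid_def by simp

lemma subset_generated: "A \<subseteq> generated_subgroupoid G A"
  unfolding generated_subgroupoid_def by blast

lemma subgroupoidD:
  assumes "subgroupoid G H"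
  shows "H \<subseteq> arrows G" "g \<in> H \<Longrightarrow> src G g \<in> H" "g \<in> H \<Longrightarrow> tgt G g \<in> H" "g \<in> H \<Longrightarrow> ginv G g \<in> H"
    "g \<in> H \<Longrightarrow> h \<in> H \<Longrightarrow> tgt G g = src G h \<Longrightarrow> gmul G g h \<in> H"
  using assms unfolding subgroupoid_def by blast+

lemma (in groupoid) subgroupoid_generated:
  assumes "A \<subseteq> arrows G"
  shows "subgroupoid G (generated_subgroupoid G A)"
proof -
  note iff = generated_subgroupoid_iff[of _ G A]
  show ?thesis
    unfolding subgroupoid_def
  proof (intro conjI ballI impI image_subsetI)
    show "generated_subgroupoid G A \<subseteq> arrows G" using subgroupoid_arrows assms iff by blast
  qed (simp_all add: iff subgroupoidD)
qed

lemma subgroupoid_sub_gpd_iff: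
  assumes "subgroupoid G K"
  shows "subgroupoid (sub_gpd G K) H \<longleftrightarrow> subgroupoid G H \<and> H \<subseteq> K"
  using subgroupoidD(1)[OF assms] unfolding subgroupoid_def sub_gpd_simps by blast

text \<open>A set that generates \<open>K\<close> inside \<open>G\<close> also generates it inside \<open>K\<close>, because subgroupoids of \<open>K\<close> are the
  subgroupoids of \<open>G\<close> contained in \<open>K\<close>.\<close>

lemma generated_subgroupoid_sub_gpd:
  assumes K: "subgroupoid G (generated_subgroupoid G A)"
  shows "generated_subgroupoid (sub_gpd G (generated_subgroupoid G A)) A = generated_subgroupoid G A"
proof (intro subset_antisym subsetI)
  fix x
  let ?K = "generated_subgroupoid G A"
  show "x \<in> ?K" if "x \<in> generated_subgroupoid (sub_gpd G ?K) A"
    using that subset_generated[of A G] K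
    by (simp add: generated_subgroupoid_iff[of x "sub_gpd G ?K"] subgroupoid_sub_gpd_iff[OF K])
  show "x \<in> generated_subgroupoid (sub_gpd G ?K) A" if "x \<in> ?K"
    using that
    by (simp add: generated_subgroupoid_iff[of x "sub_gpd G ?K"] subgroupoid_sub_gpd_iff[OF K]
        generated_subgroupoid_iff[of x G])
qed

text \<open>Wide subgroupoids of the restriction to \<open>U\<close> have object set \<open>U\<close>, so each member of the atlas knows its
  domain.\<close>

lemma (in groupoid) LQ_objects:
  assumes H: "H \<in> LQ G U" and U: "U \<subseteq> objs G"
  shows "objs (sub_gpd G H) = U" "U \<subseteq> H" "H \<inter> objs G = U"
proof -
  have wide: "objs (sub_gpd G (restr G (arrows G) U)) \<subseteq> H" "H \<subseteq> restr G (arrows G) U"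
    using H by (auto simp: LQ_def wide_subgroupoid_def subgroupoid_def)
  show UH: "U \<subseteq> H"
  proof
    fix x assume "x \<in> U"
    then have "x \<in> restr G (arrows G) U" "src G x = x" using U objD by (auto simp: restr_def)
    then have "x \<in> objs (sub_gpd G (restr G (arrows G) U))" by (force simp: objs_def)
    then show "x \<in> H" using wide by blast
  qed
  have srcU: "src G g \<in> U" if "g \<in> H" for g using that wide(2) by (auto simp: restr_def)
  show "objs (sub_gpd G H) = U"
  proof
    show "objs (sub_gpd G H) \<subseteq> U" using srcU by (auto simp: objs_def)
    show "U \<subseteq> objs (sub_gpd G H)"
    proof
      fix x assume "x \<in> U"
      then have "x \<in> H" "x = src G x" using UH U objD(2) by auto
      then show "x \<in> objs (sub_gpd G H)" unfolding objs_def by auto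
    qed
  qed
  show "H \<inter> objs G = U"
    using UH U srcU objD(2) by force
qed

section \<open>The locally Lie groupoid of a strictly regular atlas\<close>

theorem theorem3p7:
  fixes r :: diffclass
    and Q :: "'a gpd" and M :: "'a mfd"
    and I :: "'i set" and U H :: "'i \<Rightarrow> 'a set"
    and s :: "'a \<Rightarrow> 'a germ"
  assumes "lie_groupoid r Q M"
    and "lie_local_subgroupoid r Q M s"
    and "strictly_regular_atlas r Q M {(U i, H i) | i. i \<in> I} s"
  shows "locally_lie_groupoid r (sub_gpd Q (glob Q (obj_top Q M) s)) (submfd r M (\<Union>i\<in>I. H i))"
proof -
  define W where "W = (\<Union>i\<in>I. H i)"
  define K where "K = generated_subgroupoid Q W"
  define WM where "WM = submfd r M W"
  let ?X = "objs Q" and ?\<U> = "{(U i, H i) | i. i \<in> I}"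
  have union: "(\<Union>(V, L)\<in>?\<U>. L) = W" by (auto simp: W_def)

  have top: "topological_groupoid Q (mtop M)" and M: "manifold r M" and X: "submanifold r M ?X"
    and sub_src: "submersion r M (submfd r M ?X) (src Q)" and sub_tgt: "submersion r M (submfd r M ?X) (tgt Q)"
    and smooth_delta: "smooth_on r (prod_mfd M M) (src_pairs Q (arrows Q)) M (delta Q)"
    using assms(1) by (auto simp: lie_groupoid_def)
  interpret groupoid Q using top by (simp add: topological_groupoid_def)
  have arr: "topspace (mtop M) = arrows Q" using top by (simp add: topological_groupoid_def)
  have X_arr: "?X \<subseteq> arrows Q" using objD by blast

  have strict: "globally_adapted Q (obj_top Q M) ?\<U> s" "regular_atlas r Q M ?\<U> s"
      "submanifold r M W" "\<forall>(V, L)\<in>?\<U>. openin (subtopology (mtop M) W) L"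
      "openin (subtopology (prod_topology (subtopology (mtop M) W) (subtopology (mtop M) W)) (src_pairs Q W)) (delta_dom Q W)"
    using assms(3) unfolding strictly_regular_atlas_def Let_def union by blast+
  have glob: "glob Q (obj_top Q M) s = K"
    using strict(1) unfolding globally_adapted_def union K_def .
  have H_open: "openin (subtopology (mtop M) W) (H i)" if "i \<in> I" for i using strict(4) that by blast
  have lie: "lie_atlas r Q M ?\<U> s" and sect: "\<forall>(V, L)\<in>?\<U>. locally_sectionable r (sub_gpd Q L) (submfd r M L)"
    using strict(2) unfolding regular_atlas_def by blast+
  have H_sect: "locally_sectionable r (sub_gpd Q (H i)) (submfd r M (H i))" if "i \<in> I" for i using sect that by blast
  have loc: "local_atlas Q (obj_top Q M) ?\<U> s" and lies: "\<forall>(V, L)\<in>?\<U>. lie_subgroupoid r Q M L"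
    using lie unfolding lie_atlas_def by blast+
  have H_lie: "lie_subgroupoid r Q M (H i)" if "i \<in> I" for i using lies that by blast
  then have H_sub: "subgroupoid Q (H i)" and H_mfd: "submanifold r M (H i)" if "i \<in> I" for i
    using that by (auto simp: lie_subgroupoid_def)
  have U_open: "openin (obj_top Q M) (U i)" and H_LQ: "H i \<in> LQ Q (U i)" if "i \<in> I" for i
    using loc that unfolding local_atlas_def by blast+
  have top_obj: "topspace (obj_top Q M) = ?X" using arr X_arr by (auto simp: obj_top_def)
  have U_cover: "(\<Union>i\<in>I. U i) = ?X"
    using loc unfolding local_atlas_def top_obj by auto
  have U_X: "U i \<subseteq> ?X" if "i \<in> I" for i using U_cover that by blast
  have H_objs: "objs (sub_gpd Q (H i)) = U i" "U i \<subseteq> H i" "H i \<inter> ?X = U i" if "i \<in> I" for i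
    using LQ_objects[OF H_LQ[OF that] U_X[OF that]] by blast+
  have HW: "H i \<subseteq> W" if "i \<in> I" for i using that by (auto simp: W_def)
  have XW: "?X \<subseteq> W"
  proof
    fix x assume "x \<in> ?X"
    then obtain i where "i \<in> I" "x \<in> U i" using U_cover by blast
    then show "x \<in> W" using H_objs(2) HW by blast
  qed
  have W_arr: "W \<subseteq> arrows Q" using subgroupoidD(1)[OF H_sub] by (auto simp: W_def)

  have K_sub: "subgroupoid Q K" unfolding K_def by (rule subgroupoid_generated[OF W_arr])
  have WK: "W \<subseteq> K" unfolding K_def by (rule subset_generated)
  have K_objs: "objs (sub_gpd Q K) = ?X"
  proof
    show "objs (sub_gpd Q K) \<subseteq> ?X" using K_sub by (auto simp: objs_def subgroupoid_def)
    show "?X \<subseteq> objs (sub_gpd Q K)"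
    proof
      fix x assume "x \<in> ?X"
      then have "x \<in> K" "x = src Q x" using XW WK objD(2) by auto
      then show "x \<in> objs (sub_gpd Q K)" unfolding objs_def by auto
    qed
  qed
  have inv_W: "ginv Q g \<in> W" if "g \<in> W" for g using that subgroupoidD(4)[OF H_sub] by (auto simp: W_def)
  have W_inv: "ginv Q ` W = W"
  proof (intro subset_antisym subsetI)
    fix g assume g: "g \<in> W"
    then have "ginv Q (ginv Q g) = g" using W_arr inv_inv by blast
    then show "g \<in> ginv Q ` W" using inv_W[OF g] by (metis image_eqI)
  qed (use inv_W in auto)

  have WM: "manifold r WM" unfolding WM_def by (rule manifold_submfd[OF M strict(3)])
  have WM_top: "mtop WM = subtopology (mtop M) W" "topspace (mtop WM) = W"
    using W_arr arr by (auto simp: WM_def)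
  have W_top: "W \<subseteq> topspace (mtop M)" using W_arr arr by simp
  note cM = manifold_charted[OF M] and cWM = manifold_charted[OF WM]

  \<comment> \<open>Slice charts for the objects are found inside a single \<open>H i\<close>, whose charts are charts of \<open>W\<close> because it
      is open in \<open>W\<close>; there the objects of \<open>Q\<close> are exactly those of \<open>H i\<close>.\<close>
  have X_WM: "submanifold r WM ?X"
    unfolding submanifold_def
  proof (intro conjI impI subsetI)
    show "x \<in> topspace (mtop WM)" if "x \<in> ?X" for x using that XW WM_top by blast
    fix x assume r: "r \<noteq> C_top" and "x \<in> ?X"
    then obtain i where i: "i \<in> I" and x: "x \<in> U i" using U_cover by blast
    have "submanifold r (submfd r M (H i)) (U i)"
      by (rule conjunct1[OF H_sect[OF i, unfolded locally_sectionable_def H_objs(1)[OF i]]])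
    then have "x \<in> \<Union>(fst ` slice_charts r (submfd r M (H i)) (U i))"
      using r x unfolding submanifold_def by blast
    then obtain V n k \<psi> where V: "(V, n, \<psi>) \<in> charts r (submfd r M (H i))" "k \<le> n" "x \<in> V"
        "\<psi> ` (V \<inter> U i) = \<psi> ` V \<inter> topspace (Euclidean_space k)"
      unfolding slice_charts_def by auto
    have "V \<subseteq> H i"
      using V(1) openin_subset[of "subtopology (mtop M) (H i)" V] by (auto simp: charts_def is_chart_def)
    then have "V \<inter> U i = V \<inter> ?X" using H_objs(3)[OF i] by blast
    moreover have "(V, n, \<psi>) \<in> charts r WM"
      using charts_open_submfd[OF HW[OF i] H_open[OF i]] V(1) unfolding WM_def by blast
    ultimately have "(V \<inter> ?X, k, \<psi>) \<in> slice_charts r WM ?X"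
      using V(2,4) unfolding slice_charts_def by auto
    then show "x \<in> \<Union>(fst ` slice_charts r WM ?X)"
      using V(3) \<open>x \<in> ?X\<close> by (intro UnionI[of "V \<inter> ?X"]) force+
  qed

  \<comment> \<open>Source and target of \<open>Q\<close> are smooth into the submanifold of \<open>M\<close> formed by the objects; the route
      \<open>W \<rightarrow> M \<rightarrow> X \<rightarrow> M \<rightarrow> W \<rightarrow> X\<close> changes this into the submanifold of \<open>W\<close>.\<close>
  have smooth_to_X: "smooth_map r WM (submfd r WM ?X) f"
    if sub: "submersion r M (submfd r M ?X) f" and fX: "f ` arrows Q \<subseteq> ?X" for f
  proof -
    have "smooth_on r M (arrows Q) (submfd r M ?X) f"
      using sub arr by (simp add: submersion_def smooth_map_def)
    from smooth_on_compose[OF cM charted_submfd[OF X] this smooth_on_inclusion[OF order_refl] fX]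
    have "smooth_on r M (arrows Q) M f" using X_arr arr by simp
    then have "smooth_on r M W M f" using W_arr by (rule smooth_on_subset)
    then have f: "smooth_on r WM W WM f"
      unfolding WM_def by (rule smooth_on_submfds[OF M M strict(3)]) (use fX XW W_arr in auto)
    have "smooth_on r WM ?X (submfd r WM ?X) (\<lambda>x. x)"
      by (rule smooth_on_corestrict) (use XW WM_top in auto)
    from smooth_on_compose[OF cWM cWM f this] have "smooth_on r WM W (submfd r WM ?X) f"
      using fX W_arr by auto
    then show ?thesis unfolding smooth_map_def WM_top(2) .
  qed

  \<comment> \<open>Two arrows with common source may lie in different members of the atlas and their difference in a
      third, so smoothness comes from \<open>Q\<close> and not from the \<open>H i\<close>.\<close>
  have delta: "smooth_on r (prod_mfd WM WM) (delta_dom Q W) WM (delta Q)"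
  proof -
    have D: "delta_dom Q W \<subseteq> src_pairs Q (arrows Q)" "delta_dom Q W \<subseteq> W \<times> W" "delta Q ` delta_dom Q W \<subseteq> W"
      using W_arr by (auto simp: delta_dom_def src_pairs_def)
    have "smooth_on r WM W M (\<lambda>x. x)" unfolding WM_def by (rule smooth_on_inclusion[OF order_refl W_top])
    from smooth_on_subset[OF smooth_on_map_prod[OF cWM cWM this this] D(2)]
    have 1: "smooth_on r (prod_mfd WM WM) (delta_dom Q W) (prod_mfd M M) (\<lambda>x. x)"
      by (simp add: map_prod_def case_prod_beta' prod.collapse)
    have 2: "smooth_on r (prod_mfd M M) (delta_dom Q W) M (delta Q)"
      by (rule smooth_on_subset[OF smooth_delta D(1)])
    have 3: "smooth_on r M W WM (\<lambda>x. x)" unfolding WM_def by (rule smooth_on_corestrict[OF order_refl W_top])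
    note cMM = charted_prod[OF cM cM] and cWW = charted_prod[OF cWM cWM]
    from smooth_on_compose[OF cWW cMM 1 2] have "smooth_on r (prod_mfd WM WM) (delta_dom Q W) M (delta Q)" by simp
    from smooth_on_compose[OF cWW cM this 3 D(3)] show ?thesis .
  qed

  \<comment> \<open>A local section through an arrow of \<open>H i\<close> with values in \<open>H i\<close> also serves for \<open>W\<close>; it remains to
      replace the manifold of objects of \<open>H i\<close> by that of \<open>W\<close>, of which \<open>U i\<close> is an open part.\<close>
  have sectionable: "locally_sectionable r (sub_gpd Q K) WM"
    unfolding locally_sectionable_def K_objs sub_gpd_simps
  proof (intro conjI X_WM ballI)
    fix w assume "w \<in> topspace (mtop WM)"
    then obtain i where i: "i \<in> I" and w: "w \<in> H i" using WM_top by (auto simp: W_def)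
    let ?N = "submfd r WM ?X" and ?Ni = "submfd r (submfd r M (H i)) (U i)"
    have Hi_top: "H i \<subseteq> topspace (mtop M)" using HW[OF i] W_top by blast
    have "w \<in> topspace (mtop (submfd r M (H i)))" using w Hi_top by auto
    then obtain B \<sigma> where \<sigma>: "admissible_local_section r (sub_gpd Q (H i)) ?Ni B \<sigma>"
        "src Q w \<in> B" "\<sigma> (src Q w) = w" "\<sigma> ` B \<subseteq> topspace (mtop (submfd r M (H i)))"
        "smooth_on r ?Ni B (submfd r M (H i)) \<sigma>"
      using bspec[OF conjunct2[OF H_sect[OF i, unfolded locally_sectionable_def H_objs(1)[OF i] sub_gpd_simps]]]
      by blast
    have Ui: "submanifold r (submfd r M (H i)) (U i)"
      by (rule conjunct1[OF H_sect[OF i, unfolded locally_sectionable_def H_objs(1)[OF i]]])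
    let ?C = "(tgt Q \<circ> \<sigma>) ` B"
    have adm: "openin (mtop ?Ni) B" "\<sigma> ` B \<subseteq> H i" "\<forall>x\<in>B. src Q (\<sigma> x) = x" "openin (mtop ?Ni) ?C"
        "bij_betw (tgt Q \<circ> \<sigma>) B ?C" "smooth_on r ?Ni B ?Ni (tgt Q \<circ> \<sigma>)"
        "smooth_on r ?Ni ?C ?Ni (inv_into B (tgt Q \<circ> \<sigma>))"
      using \<sigma>(1) unfolding admissible_local_section_def diffeo_on_def sub_gpd_simps by blast+
    have BC: "B \<subseteq> U i" "?C \<subseteq> U i"
      using openin_subset[OF adm(1)] openin_subset[OF adm(4)] by auto
    have N_top: "mtop ?Ni = subtopology (mtop ?N) (U i)" and Ui_open: "openin (mtop ?N) (U i)"
    proof -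
      have "W \<inter> ?X = ?X" "H i \<inter> U i = U i" "?X \<inter> U i = U i" using XW H_objs(2)[OF i] U_X[OF i] by blast+
      then show "mtop ?Ni = subtopology (mtop ?N) (U i)" "openin (mtop ?N) (U i)"
        using U_open[OF i] by (simp_all add: WM_def subtopology_subtopology obj_top_def)
    qed
    have opn: "openin (mtop ?N) A" if "openin (mtop ?Ni) A" for A
      using openin_trans_full[OF that[unfolded N_top] Ui_open] .
    note cN = charted_submfd[OF X_WM] and cNi = charted_submfd[OF Ui]
    have N_Ni: "smooth_on r ?N A ?Ni (\<lambda>x. x)" and Ni_N: "smooth_on r ?Ni A ?N (\<lambda>x. x)" if "A \<subseteq> U i" for A
      unfolding WM_def
      by (rule smooth_on_id_nested[OF M],
          use strict(3) H_mfd[OF i] X_WM Ui that H_objs(2)[OF i] HW[OF i] U_X[OF i] in \<open>auto simp: WM_def\<close>)+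
    have transfer: "smooth_on r ?N A ?N f" if f: "smooth_on r ?Ni A ?Ni f" and A: "A \<subseteq> U i" "f ` A \<subseteq> U i" for A f
    proof -
      have "smooth_on r ?N A ?Ni f"
        using smooth_on_compose[OF cN cNi N_Ni[OF A(1)] f] by simp
      from smooth_on_compose[OF cN cNi this Ni_N[OF A(2)]] show ?thesis by simp
    qed
    have inv_C: "inv_into B (tgt Q \<circ> \<sigma>) ` ?C \<subseteq> U i"
      using inv_into_into[of _ "tgt Q \<circ> \<sigma>" B] BC(1) by blast
    have "diffeo_on r ?N B ?N ?C (tgt Q \<circ> \<sigma>)"
      unfolding diffeo_on_def
      by (intro conjI adm(5) transfer[OF adm(6) BC] transfer[OF adm(7) BC(2) inv_C])
    moreover have "\<sigma> ` B \<subseteq> K" using adm(2) HW[OF i] WK by blast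
    ultimately have "admissible_local_section r (sub_gpd Q K) ?N B \<sigma>"
      unfolding admissible_local_section_def sub_gpd_simps
      using opn[OF adm(1)] adm(3) opn[OF adm(4)] by (intro conjI)
    moreover have "smooth_on r ?N B WM \<sigma>"
    proof -
      have "smooth_on r ?N B (submfd r M (H i)) \<sigma>"
        using smooth_on_compose[OF cN cNi N_Ni[OF BC(1)] \<sigma>(5)] by simp
      from smooth_on_compose[OF cN charted_submfd[OF H_mfd[OF i]] this smooth_on_inclusion[OF order_refl Hi_top] adm(2)]
      have "smooth_on r ?N B M \<sigma>" .
      from smooth_on_compose[OF cN cM this smooth_on_corestrict[OF order_refl W_top]]
      show ?thesis unfolding WM_def[symmetric] using order_trans[OF adm(2) HW[OF i]] .
    qed
    ultimately show "\<exists>B \<sigma>. admissible_local_section r (sub_gpd Q K) ?N B \<sigma> \<and> src Q w \<in> B \<and>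
        \<sigma> (src Q w) = w \<and> \<sigma> ` B \<subseteq> topspace (mtop WM) \<and> smooth_on r ?N B WM \<sigma>"
      unfolding WM_top(2) using \<sigma>(2,3) order_trans[OF adm(2) HW[OF i]]
      by (intro exI[of _ B] exI[of _ \<sigma>] conjI)
  qed

  have "locally_lie_groupoid r (sub_gpd Q K) WM"
    unfolding locally_lie_groupoid_def Let_def WM_top(2) K_objs sub_gpd_simps
      src_pairs_sub_gpd delta_sub_gpd delta_dom_sub_gpd
  proof (intro conjI)
    show "groupoid (sub_gpd Q K)" by (rule groupoid_sub_gpd[OF groupoid_axioms K_sub])
    show "openin (subtopology (prod_topology (mtop WM) (mtop WM)) (src_pairs Q W)) (delta_dom Q W)"
      using strict(5) by (simp add: WM_top(1))
    have "src Q ` arrows Q \<subseteq> ?X" "tgt Q ` arrows Q \<subseteq> ?X"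
      using src_tgt tgt_closed by (force simp: objs_def)+
    then show "smooth_map r WM (submfd r WM ?X) (src Q)" "smooth_map r WM (submfd r WM ?X) (tgt Q)"
      using smooth_to_X sub_src sub_tgt by blast+
    show "generated_subgroupoid (sub_gpd Q K) W = K"
      using generated_subgroupoid_sub_gpd K_sub unfolding K_def by blast
  qed (use WM XW WK W_inv delta sectionable in auto)
  then show ?thesis by (simp add: glob WM_def W_def)
qed

end
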